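(* Let $E$ and $S$ be Polish spaces endowed with arbitrary filtrations $(\mathcal{B}_t(E))_{t\in I}$, $(\mathcal{B}_t(S))_{t\in I}$ of their Borel sigma-fields indexed by a same totally ordered set $I$. Let $c:E\times S\to\mathbb{R}\cup\{+\infty\}$ be a non-negative lower semi-continuous map. Then for any $\eta\in\mathcal{P}_E$ and $\nu\in\mathcal{P}_S$ there exists $\gamma\in\Pi_c(\eta,\nu)$ which attains the infimum $$\inf\left\{\int_{E\times S}c(x,y)\,d\gamma(x,y)\ :\ \gamma\in\Pi_c(\eta,\nu)\right\}.$$
   Context: A filtration $(\mathcal{B}_t(E))_{t\in I}$ of $\mathcal{B}(E)$ is a family of sigma-fields with $\mathcal{B}_s(E)\subset\mathcal{B}_t(E)\subset\mathcal{B}(E)$ for $s\le t$ (similarly on $S$). $\mathcal{P}_Z$ is the set of Borel probabilities on a Polish space $Z$. For a sigma-field $\mathcal{G}\subset\mathcal{B}(E)$, $\mathcal{G}^\eta$ is its $\eta$-completion (generated by $\mathcal{G}$ and the $\eta$-negligible sets). With $\pi,\widetilde\pi$ the projections of $E\times S$ onto $E$, $S$, $\Pi(\eta,\nu)=\{\gamma\in\mathcal{P}_{E\times S}:\pi_\star\gamma=\eta,\ \widetilde\pi_\star\gamma=\nu\}$. A kernel associated to $\gamma\in\Pi(\eta,\nu)$ is a map $\Theta_\gamma:E\times\mathcal{B}(S)\to\mathbb{R}$ with $\Theta^x_\gamma\in\mathcal{P}_S$ for all $x$, $x\mapsto\Theta^x_\gamma(B)$ Borel for all $B$, and $\gamma(A\times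 B)=\int_A\Theta^x_\gamma(B)\,d\eta(x)$ for all $A\in\mathcal{B}(E),B\in\mathcal{B}(S)$. For $t\in I$, $\mathcal{G}_t(\gamma)$ is the $\eta$-completion of the smallest sigma-field on $E$ making $x\mapsto\Theta^x_\gamma(C)$ measurable for every $C\in\mathcal{B}_t(S)$ with $\nu(\partial C)=0$. Causal transference plans: $\Pi_c(\eta,\nu)=\{\gamma\in\Pi(\eta,\nu):\mathcal{G}_t(\gamma)\subset\mathcal{B}_t(E)^\eta\ \text{for all }t\in I\}$. *)

theory Defs
  imports "HOL-Probability.Probability"
begin

text \<open>
  A sigma-field is a measure-typed object of which only the underlying sets matter, as in
  \<^const>\<open>subalgebra\<close>. The library locale for filtrations requires an index type with a
  second-countable order topology; here the index set is an arbitrary totally ordered set,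
  given as a subset (possibly empty) of a linearly ordered type.
\<close>

definition borel_filtration ::
    "'i::linorder set \<Rightarrow> ('i \<Rightarrow> 'a::topological_space measure) \<Rightarrow> bool" where
  "borel_filtration I F \<longleftrightarrow>
     (\<forall>t\<in>I. subalgebra borel (F t)) \<and>
     (\<forall>s\<in>I. \<forall>t\<in>I. s \<le> t \<longrightarrow> sets (F s) \<subseteq> sets (F t))"

text \<open>
  The \<open>\<eta>\<close>-negligible sets are all subsets of \<open>\<eta>\<close>-null Borel sets, whether or not these null sets
  belong to the sigma-field that is completed. (The library's \<^const>\<open>completion\<close> would
  only add subsets of null sets of that smaller sigma-field.)
\<close>

definition negl_completion :: "'a measure \<Rightarrow> 'a measure \<Rightarrow> 'a measure" where
  "negl_completion \<eta> G =
     sigma (space \<eta>) (sets G \<union> {N. \<exists>N'\<in>null_sets \<eta>. N \<subseteq> N'})"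

definition transport_plans ::
    "'a::topological_space measure \<Rightarrow> 'b::topological_space measure \<Rightarrow> ('a \<times> 'b) measure set"
  where
  "transport_plans \<eta> \<nu> =
     {\<gamma> \<in> space (prob_algebra borel). distr \<gamma> borel fst = \<eta> \<and> distr \<gamma> borel snd = \<nu>}"

text \<open>
  Measurability into \<^const>\<open>prob_algebra\<close> says that every \<open>\<Theta> x\<close> is a Borel probability and
  that \<open>x \<mapsto> \<Theta> x B\<close> is Borel for every Borel set \<open>B\<close>.
\<close>

definition associated_kernel ::
    "'a::topological_space measure \<Rightarrow> ('a \<times> 'b::topological_space) measure \<Rightarrow>
     ('a \<Rightarrow> 'b measure) \<Rightarrow> bool" where
  "associated_kernel \<eta> \<gamma> \<Theta> \<longleftrightarrow>
     \<Theta> \<in> borel \<rightarrow>\<^sub>M prob_algebra borel \<and>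
     (\<forall>A\<in>sets borel. \<forall>B\<in>sets borel.
        emeasure \<gamma> (A \<times> B) = (\<integral>\<^sup>+x\<in>A. emeasure (\<Theta> x) B \<partial>\<eta>))"

definition kernel_field ::
    "'a::topological_space measure \<Rightarrow> 'b::topological_space measure \<Rightarrow> ('a \<Rightarrow> 'b measure) \<Rightarrow>
     'b measure \<Rightarrow> 'a measure" where
  "kernel_field \<eta> \<nu> \<Theta> H = negl_completion \<eta>
     (sigma UNIV {(\<lambda>x. measure (\<Theta> x) C) -` U | C U.
        C \<in> sets H \<and> measure \<nu> (frontier C) = 0 \<and> U \<in> sets (borel :: real measure)})"

text \<open>
  The field \<open>kernel_field \<eta> \<nu> \<Theta> (H t)\<close> depends on the plan only, and not on the version of its
  kernel: see \<open>kernel_field_unique\<close> below. Hence quantifying the kernel existentially or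
  universally makes no difference.
\<close>

definition causal_plans ::
    "'i set \<Rightarrow> ('i \<Rightarrow> 'a::topological_space measure) \<Rightarrow> ('i \<Rightarrow> 'b::topological_space measure) \<Rightarrow>
     'a measure \<Rightarrow> 'b measure \<Rightarrow> ('a \<times> 'b) measure set" where
  "causal_plans I F H \<eta> \<nu> =
     {\<gamma> \<in> transport_plans \<eta> \<nu>.
        \<exists>\<Theta>. associated_kernel \<eta> \<gamma> \<Theta> \<and>
          (\<forall>t\<in>I. sets (kernel_field \<eta> \<nu> \<Theta> (H t)) \<subseteq> sets (negl_completion \<eta> (F t)))}"

definition lower_semicontinuous :: "('a::topological_space \<Rightarrow> 'b::linorder) \<Rightarrow> bool" where
  "lower_semicontinuous f \<longleftrightarrow> (\<forall>a. open {x. a < f x})"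

lemma associated_kernel_AE_unique:
  fixes \<eta> :: "'a::topological_space measure" and \<gamma> :: "('a \<times> 'b::second_countable_topology) measure"
  assumes \<eta>: "prob_space \<eta>" "sets \<eta> = sets borel"
    and K: "associated_kernel \<eta> \<gamma> \<Theta>" and K': "associated_kernel \<eta> \<gamma> \<Theta>'"
  shows "AE x in \<eta>. \<Theta> x = \<Theta>' x"
proof -
  interpret prob_space \<eta> by fact
  obtain \<B> :: "'b set set" where \<B>: "countable \<B>" "topological_basis \<B>"
    using ex_countable_basis by blast
  define \<E> where "\<E> = insert UNIV (\<Inter> ` {F. finite F \<and> F \<subseteq> \<B>})"
  have cnt: "countable \<E>"
    unfolding \<E>_def by (intro countable_insert countable_image countable_Collect_finite_subset \<B>)
  have stable: "Int_stable \<E>"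
  proof (rule Int_stableI)
    fix a b assume a: "a \<in> \<E>" and b: "b \<in> \<E>"
    have "\<E> = \<Inter> ` {F. finite F \<and> F \<subseteq> \<B>}"
    proof -
      have "\<Inter>{} \<in> \<Inter> ` {F. finite F \<and> F \<subseteq> \<B>}" by (rule imageI) simp
      then show ?thesis unfolding \<E>_def by (simp add: insert_absorb)
    qed
    then obtain F G where "finite F" "F \<subseteq> \<B>" "a = \<Inter>F" "finite G" "G \<subseteq> \<B>" "b = \<Inter>G"
      using a b by auto
    then have "a \<inter> b = \<Inter>(F \<union> G)" "finite (F \<union> G)" "F \<union> G \<subseteq> \<B>" by auto
    then show "a \<inter> b \<in> \<E>" unfolding \<E>_def by blast
  qed
  have "open A" if A: "A \<in> \<E>" for A
  proof -
    consider "A = UNIV" | F where "finite F" "F \<subseteq> \<B>" "A = \<Inter>F"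
      using A unfolding \<E>_def by blast
    then show ?thesis
    proof cases
      case 2
      then show ?thesis
        using topological_basis_open[OF \<B>(2)] by (auto intro!: open_Inter)
    qed simp
  qed
  then have borelE: "A \<in> sets borel" if "A \<in> \<E>" for A using that by simp
  have sub: "\<B> \<subseteq> \<E>"
  proof
    fix B assume "B \<in> \<B>"
    then have "\<Inter>{B} \<in> \<E>" unfolding \<E>_def by blast
    then show "B \<in> \<E>" by simp
  qed
  have gen: "sets (borel :: 'b measure) = sigma_sets UNIV \<E>"
  proof (rule antisym)
    have "sets (borel :: 'b measure) = sigma_sets UNIV \<B>"
      unfolding borel_eq_countable_basis[OF \<B>] by (rule sets_measure_of) simp
    also have "\<dots> \<subseteq> sigma_sets UNIV \<E>" using sub by (rule sigma_sets_mono')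
    finally show "sets (borel :: 'b measure) \<subseteq> sigma_sets UNIV \<E>" .
    show "sigma_sets UNIV \<E> \<subseteq> sets (borel :: 'b measure)"
      using sets.sigma_sets_subset[of \<E> "borel :: 'b measure"] borelE by auto
  qed
  have m: "(\<lambda>x. emeasure (\<Phi> x) B) \<in> borel_measurable \<eta>"
    and s: "prob_space (\<Phi> x)" "sets (\<Phi> x) = sets borel"
    if "associated_kernel \<eta> \<gamma> \<Phi>" "B \<in> sets borel" for \<Phi> :: "'a \<Rightarrow> 'b measure" and B x
  proof -
    have \<Phi>: "\<Phi> \<in> borel \<rightarrow>\<^sub>M prob_algebra borel"
      using that(1) by (simp add: associated_kernel_def)
    then have "\<Phi> \<in> \<eta> \<rightarrow>\<^sub>M subprob_algebra borel"
      using measurable_cong_sets[OF \<eta>(2) refl] measurable_prob_algebraD by blast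
    then show "(\<lambda>x. emeasure (\<Phi> x) B) \<in> borel_measurable \<eta>"
      using that(2) by (rule measurable_emeasure_kernel)
    have "\<Phi> x \<in> space (prob_algebra borel)"
      using measurable_space[OF \<Phi>] by simp
    then show "prob_space (\<Phi> x)" "sets (\<Phi> x) = sets borel"
      by (auto simp: space_prob_algebra)
  qed
  have "AE x in \<eta>. emeasure (\<Theta> x) B = emeasure (\<Theta>' x) B" if "B \<in> \<E>" for B
  proof (rule density_unique2)
    have B: "B \<in> sets borel" using borelE that by blast
    show "(\<lambda>x. emeasure (\<Theta> x) B) \<in> borel_measurable \<eta>" using m K B by blast
    show "(\<lambda>x. emeasure (\<Theta>' x) B) \<in> borel_measurable \<eta>" using m K' B by blast
    show "(\<integral>\<^sup>+x\<in>A. emeasure (\<Theta> x) B \<partial>\<eta>) = (\<integral>\<^sup>+x\<in>A. emeasure (\<Theta>' x) B \<partial>\<eta>)"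
      if "A \<in> sets \<eta>" for A
      using K K' B that \<eta>(2) unfolding associated_kernel_def by metis
  qed
  then have "AE x in \<eta>. \<forall>B\<in>\<E>. emeasure (\<Theta> x) B = emeasure (\<Theta>' x) B"
    using cnt by (simp add: AE_ball_countable)
  then show ?thesis
  proof eventually_elim
    fix x assume eq: "\<forall>B\<in>\<E>. emeasure (\<Theta> x) B = emeasure (\<Theta>' x) B"
    show "\<Theta> x = \<Theta>' x"
    proof (rule measure_eqI_generator_eq[OF stable, where A = "\<lambda>_. UNIV"])
      show "sets (\<Theta> x) = sigma_sets UNIV \<E>" "sets (\<Theta>' x) = sigma_sets UNIV \<E>"
        using s(2)[OF K sets.empty_sets] s(2)[OF K' sets.empty_sets] by (simp_all only: gen)
      interpret X: prob_space "\<Theta> x" by (rule s(1)[OF K sets.empty_sets])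
      show "emeasure (\<Theta> x) UNIV \<noteq> \<infinity>" by simp
    qed (use eq in \<open>auto simp: \<E>_def\<close>)
  qed
qed

lemma kernel_field_unique:
  fixes \<eta> :: "'a::topological_space measure" and \<gamma> :: "('a \<times> 'b::second_countable_topology) measure"
  assumes \<eta>: "prob_space \<eta>" "sets \<eta> = sets borel"
    and K: "associated_kernel \<eta> \<gamma> \<Theta>" and K': "associated_kernel \<eta> \<gamma> \<Theta>'"
  shows "kernel_field \<eta> \<nu> \<Theta> H = kernel_field \<eta> \<nu> \<Theta>' H"
proof -
  define \<N> where "\<N> = {N. \<exists>N'\<in>null_sets \<eta>. N \<subseteq> N'}"
  define gens where "gens \<Phi> = {(\<lambda>x. measure (\<Phi> x) C) -` U | C U.
    C \<in> sets H \<and> measure \<nu> (frontier C) = 0 \<and> U \<in> sets (borel :: real measure)}"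
    for \<Phi> :: "'a \<Rightarrow> 'b measure"
  have sp: "space \<eta> = UNIV" using \<eta>(2) sets_eq_imp_space_eq by fastforce
  have incl: "sigma_sets UNIV (sigma_sets UNIV (gens \<Phi>) \<union> \<N>) \<subseteq>
      sigma_sets UNIV (sigma_sets UNIV (gens \<Psi>) \<union> \<N>)" (is "_ \<subseteq> ?R")
    if ae: "AE x in \<eta>. \<Phi> x = \<Psi> x" for \<Phi> \<Psi>
  proof (rule sigma_sets_mono)
    interpret R: sigma_algebra UNIV ?R by (rule sigma_algebra_sigma_sets) simp
    obtain Z where Z: "{x. \<Phi> x \<noteq> \<Psi> x} \<subseteq> Z" "Z \<in> null_sets \<eta>"
      using ae sp unfolding eventually_ae_filter by auto
    have "gens \<Phi> \<subseteq> ?R"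
    proof
      fix A assume "A \<in> gens \<Phi>"
      then obtain C U where A: "A = (\<lambda>x. measure (\<Phi> x) C) -` U"
        and CU: "C \<in> sets H" "measure \<nu> (frontier C) = 0" "U \<in> sets borel"
        unfolding gens_def by blast
      define A' where "A' = (\<lambda>x. measure (\<Psi> x) C) -` U"
      have "A' \<in> gens \<Psi>" unfolding gens_def A'_def using CU by blast
      then have "A' \<in> ?R" by (intro sigma_sets.Basic UnI1)
      moreover have "Z \<in> ?R" "A \<inter> Z \<in> ?R"
        using Z(2) by (auto intro!: sigma_sets.Basic UnI2 simp: \<N>_def)
      ultimately have "(A' - Z) \<union> (A \<inter> Z) \<in> ?R" by blast
      moreover have "A = (A' - Z) \<union> (A \<inter> Z)"
      proof -
        have "\<Phi> x = \<Psi> x" if "x \<notin> Z" for x using Z(1) that by blast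
        then show ?thesis unfolding A A'_def by auto
      qed
      ultimately show "A \<in> ?R" by simp
    qed
    then have "sigma_sets UNIV (gens \<Phi>) \<subseteq> ?R" by (rule R.sigma_sets_subset)
    then show "sigma_sets UNIV (gens \<Phi>) \<union> \<N> \<subseteq> ?R" by (auto intro: sigma_sets.Basic)
  qed
  have ae: "AE x in \<eta>. \<Theta> x = \<Theta>' x"
    by (rule associated_kernel_AE_unique[OF assms])
  then have "AE x in \<eta>. \<Theta>' x = \<Theta> x" by eventually_elim simp
  with ae have eq: "sigma_sets UNIV (sigma_sets UNIV (gens \<Theta>) \<union> \<N>) =
      sigma_sets UNIV (sigma_sets UNIV (gens \<Theta>') \<union> \<N>)"
    by (intro antisym incl)
  show ?thesis
    unfolding kernel_field_def negl_completion_def sp gens_def[symmetric] \<N>_def[symmetric]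
    by (rule sigma_eqI) (use eq in simp_all)
qed

end

(*
A plan is determined by its values on rectangles A x B, and since all plans share their marginals,
no topology is needed to extract limits: by Tychonoff's theorem every sequence of plans has a
cluster point m in [0,1]^(rectangles), i.e. a filter G along which gamma_n(A x B) tends to m(A,B)
for all Borel A and B at once. The limit m is biadditive with marginals eta and nu. Radon-Nikodym
densities of m(.,B) for B in a countable algebra, made countably additive almost everywhere by
inner regularity of nu, yield a kernel that disintegrates m; so m comes from a plan.

Causality says that x -> Theta^x(C) coincides a.e. with an F_t-measurable function, that is, it is
orthogonal to 1_A - E[1_A | F_t] for every Borel A. This is linear and passes to the limit along G.

Open sets are countable increasing unions of finite unions of open rectangles, hence
gamma_n -> gamma on rectangles gives lower semicontinuity of the cost, and a minimizing sequence
clusters at a minimizer.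
*)

theory Submission
  imports Defs "HOL-Real_Asymp.Real_Asymp"
begin

section \<open>Disintegration of bimeasures\<close>

text \<open>The obstacle is that the limit \<open>m\<close> is a priori only a bimeasure. Since
  m(A,B) is at most \<eta>(A) and at most \<nu>(B), it is countably additive in each variable
  separately, but this does not in general yield a measure on the product. Compact subsets of the
  second factor close the gap: a decreasing sequence with empty intersection is controlled by
  finitely many of them. Convergence on all Borel rectangles, instead of weak convergence, is what
  makes causality stable: the integral of 1_A against Theta_n(C) is exactly gamma_n(A x C), so the
  kernels evaluated at a fixed Borel set C converge weakly against indicators, whatever the topology
  does near the boundary of C. The price is that there are uncountably many rectangles, so the
  cluster point is reached along a filter and not along a subsequence. Along such a filter neither
  dominated nor monotone convergence is available. Every passage to the limit in \<open>G\<close>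
  therefore rests on uniqueness of limits, preservation of inequalities, finite sums and uniform
  approximation only; countable limit theorems are applied to other, genuinely sequential
  indices.\<close>

lemma countable_algebra_extension:
  fixes X :: "'a set set"
  assumes "countable X"
  obtains \<A> where "countable \<A>" "X \<subseteq> \<A>" "algebra UNIV \<A>"
proof -
  \<comment> \<open>Each stage adds complements and pairwise unions. A single operation involves at
    most two sets, which already lie in a common stage, so the union of the countable stages is
    closed.\<close>
  define S where "S = rec_nat (insert {} X) (\<lambda>_ T. T \<union> uminus ` T \<union> (\<lambda>(a, b). a \<union> b) ` (T \<times> T))"
  have S0: "S 0 = insert {} X"
    and Suc: "S (Suc n) = S n \<union> uminus ` S n \<union> (\<lambda>(a, b). a \<union> b) ` (S n \<times> S n)" for n
    by (simp_all add: S_def)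
  have cnt: "countable (S n)" for n
    by (induction n) (use assms in \<open>auto simp: S0 Suc\<close>)
  have inc: "S m \<subseteq> S n" if "m \<le> n" for m n
    using that by (rule lift_Suc_mono_le[rotated]) (auto simp: Suc)
  show thesis
  proof
    show "countable (\<Union>n. S n)" using cnt by blast
    show "X \<subseteq> (\<Union>n. S n)" using S0 by blast
    show "algebra UNIV (\<Union>n. S n)"
      unfolding algebra_iff_Un
    proof (intro conjI ballI)
      show "{} \<in> (\<Union>n. S n)" using S0 by blast
      show "UNIV - a \<in> (\<Union>n. S n)" if "a \<in> (\<Union>n. S n)" for a
      proof -
        from that obtain n where "a \<in> S n" by blast
        then have "- a \<in> S (Suc n)" by (auto simp: Suc)
        then show ?thesis by (auto simp: Compl_eq_Diff_UNIV)
      qed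
      show "a \<union> b \<in> (\<Union>n. S n)" if "a \<in> (\<Union>n. S n)" "b \<in> (\<Union>n. S n)" for a b
      proof -
        from that obtain n k where "a \<in> S n" "b \<in> S k" by blast
        then have "a \<in> S (max n k)" "b \<in> S (max n k)"
          using inc[of n "max n k"] inc[of k "max n k"] by auto
        then have "a \<union> b \<in> S (Suc (max n k))" by (force simp: Suc)
        then show ?thesis by blast
      qed
    qed simp
  qed
qed

text \<open>The sets \<open>A\<close> range over an algebra \<open>\<A>0\<close> whose compact approximants live in a larger one,
  so that both algebras can be countable.\<close>

lemma prob_extension_of_compact_approx:
  fixes h :: "'b::t2_space set \<Rightarrow> ennreal"
  assumes A0: "algebra UNIV \<A>0" and A1: "algebra UNIV \<A>1" and sub: "\<A>0 \<subseteq> \<A>1"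
    and gen: "sigma_sets UNIV \<A>0 = sets borel"
    and empty: "h {} = 0" and UNIV: "h UNIV = 1"
    and add: "\<And>A B. A \<in> \<A>1 \<Longrightarrow> B \<in> \<A>1 \<Longrightarrow> A \<inter> B = {} \<Longrightarrow> h (A \<union> B) = h A + h B"
    and approx: "\<And>A e. A \<in> \<A>0 \<Longrightarrow> 0 < e \<Longrightarrow> \<exists>K\<in>\<A>1. compact K \<and> K \<subseteq> A \<and> h (A - K) < ennreal e"
  shows "\<exists>M. prob_space M \<and> sets M = sets borel \<and> (\<forall>A\<in>\<A>0. emeasure M A = h A)"
proof -
  interpret A0: algebra UNIV \<A>0 by fact
  interpret A1: algebra UNIV \<A>1 by fact
  have pos: "positive \<A> h" for \<A> by (simp add: positive_def empty)
  have add1: "additive \<A>1 h" using add by (auto simp: additive_def)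
  then have add0: "additive \<A>0 h" using sub by (auto simp: additive_def)
  have mono: "h A \<le> h B" if "A \<in> \<A>1" "B \<in> \<A>1" "A \<subseteq> B" for A B
    using A1.additive_increasing[OF pos add1] that by (auto simp: increasing_def)
  have fin: "h A \<noteq> \<infinity>" if "A \<in> \<A>0" for A
  proof -
    have "h A \<le> 1" using mono[of A UNIV] that sub UNIV A1.top by auto
    then show ?thesis by (auto simp: top_unique)
  qed
  \<comment> \<open>Continuity at the empty set is what Caratheodory's theorem asks of a finite
    additive function in order to extend it.\<close>
  have cont: "(\<lambda>i. h (A i)) \<longlonglongrightarrow> 0"
    if A: "range A \<subseteq> \<A>0" "decseq A" "(\<Inter>i. A i) = {}" for A :: "nat \<Rightarrow> _"
  proof (rule tendsto_zero_ennreal)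
    fix r :: real assume r: "0 < r"
    \<comment> \<open>The errors sum to at most r/2 over all indices, which leaves room for the
      strict bound by r.\<close>
    define e where "e i = r * (1/2) ^ Suc (Suc i)" for i
    have e: "0 < e i" for i using r by (simp add: e_def)
    have "\<exists>K. K \<in> \<A>1 \<and> compact K \<and> K \<subseteq> A i \<and> h (A i - K) < ennreal (e i)" for i
      using approx[OF _ e, of "A i" i] A(1) by blast
    then have "\<exists>K. \<forall>i. K i \<in> \<A>1 \<and> compact (K i) \<and> K i \<subseteq> A i \<and> h (A i - K i) < ennreal (e i)"
      by (intro choice allI)
    then obtain K where K: "\<And>i. K i \<in> \<A>1" "\<And>i. compact (K i)" "\<And>i. K i \<subseteq> A i"
      "\<And>i. h (A i - K i) < ennreal (e i)" by auto
    \<comment> \<open>Finite intersection property: the compact sets lie inside the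
      \<open>A i\<close>, whose intersection is empty, so finitely many of them already have no
      common point.\<close>
    have "\<exists>n. (\<Inter>i\<le>n. K i) = {}"
    proof (rule ccontr)
      assume *: "\<not> (\<exists>n. (\<Inter>i\<le>n. K i) = {})"
      have "K 0 \<inter> (\<Inter>i\<in>UNIV. K i) \<noteq> {}"
      proof (rule compact_imp_fip_image)
        fix I :: "nat set" assume "finite I"
        then obtain n where "I \<subseteq> {..n}" by (meson atMost_iff finite_nat_iff_bounded_le)
        moreover have "(\<Inter>i\<le>n. K i) \<noteq> {}" using * by blast
        ultimately show "K 0 \<inter> (\<Inter>i\<in>I. K i) \<noteq> {}" by (auto simp: subset_eq)
      qed (use K(2) in \<open>auto intro: compact_imp_closed\<close>)
      moreover have "(\<Inter>i. K i) \<subseteq> (\<Inter>i. A i)" using K(3) by (intro INF_mono') simp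
      ultimately show False using A(3) by auto
    qed
    then obtain n where n: "(\<Inter>i\<le>n. K i) = {}" by blast
    have AA: "A i \<in> \<A>1" for i using A(1) sub by blast
    have AK: "range (\<lambda>i. A i - K i) \<subseteq> \<A>1" using AA K(1) by auto
    \<comment> \<open>A point of \<open>A n\<close> belongs to every earlier \<open>A i\<close> but
      misses some \<open>K i\<close> with \<open>i \<le> n\<close>.\<close>
    have "A n \<subseteq> (\<Union>i\<in>{..n}. A i - K i)"
    proof
      fix y assume y: "y \<in> A n"
      from n obtain i where "i \<le> n" "y \<notin> K i" by blast
      moreover have "y \<in> A i" using A(2) y \<open>i \<le> n\<close> by (auto simp: decseq_def)
      ultimately show "y \<in> (\<Union>i\<in>{..n}. A i - K i)" by blast
    qed
    then have "h (A n) \<le> h (\<Union>i\<in>{..n}. A i - K i)"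
      using AA AK by (intro mono A1.finite_UN) auto
    also have "\<dots> \<le> (\<Sum>i\<in>{..n}. h (A i - K i))"
      using AK by (intro A1.subadditive[OF pos add1]) auto
    also have "\<dots> \<le> (\<Sum>i\<in>{..n}. ennreal (e i))"
      by (intro sum_mono less_imp_le K)
    also have "\<dots> = ennreal (\<Sum>i\<le>n. e i)"
      using e by (simp add: less_imp_le sum_ennreal)
    also have "(\<Sum>i\<le>n. e i) = r / 2 * (1 - (1/2) ^ Suc n)"
      by (induction n) (simp_all add: e_def field_simps)
    also have "ennreal \<dots> < ennreal r"
    proof (rule ennreal_lessI)
      have "r / 2 * (1 - (1/2) ^ Suc n) \<le> r / 2" using r by (simp add: mult_le_cancel_left1)
      also have "\<dots> < r" using r by simp
      finally show "r / 2 * (1 - (1/2) ^ Suc n) < r" .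
    qed fact
    finally have "h (A n) < ennreal r" .
    moreover have "h (A k) \<le> h (A n)" if "n \<le> k" for k
      using A(2) AA that by (intro mono) (auto simp: decseq_def)
    ultimately show "\<forall>\<^sub>F i in sequentially. h (A i) < ennreal r"
      unfolding eventually_sequentially by (meson le_less_trans)
  qed
  obtain \<mu> where \<mu>: "\<forall>A\<in>\<A>0. \<mu> A = h A" "measure_space UNIV (sigma_sets UNIV \<A>0) \<mu>"
    using A0.caratheodory_empty_continuous[OF pos add0 fin cont] by blast
  define M where "M = measure_of UNIV (sigma_sets UNIV \<A>0) \<mu>"
  have sM: "sets M = sigma_sets UNIV \<A>0"
    unfolding M_def by (simp add: sigma_sets_sigma_sets_eq)
  have eM: "emeasure M A = h A" if "A \<in> \<A>0" for A
  proof -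
    have "emeasure M A = \<mu> A"
      unfolding M_def using \<mu>(2) that
      by (intro emeasure_measure_of_sigma) (auto simp: measure_space_def)
    then show ?thesis using \<mu>(1) that by simp
  qed
  have "space M = UNIV" by (simp add: M_def)
  then have "prob_space M" using eM[OF A0.top] UNIV by (intro prob_spaceI) simp
  then show ?thesis using sM gen eM by auto
qed

text \<open>Domination by a finite measure forces continuity at the empty set, which upgrades finite
  to countable additivity. It serves for both sections of a bimeasure: in the first variable below
  \<open>\<eta>\<close>, in the second below \<open>\<nu>\<close>.\<close>

lemma measure_of_dominated_additive:
  fixes f :: "'a set \<Rightarrow> real"
  assumes "finite_measure M"
    and nonneg: "\<And>A. A \<in> sets M \<Longrightarrow> 0 \<le> f A"
    and dom: "\<And>A. A \<in> sets M \<Longrightarrow> f A \<le> measure M A"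
    and add: "\<And>A B. A \<in> sets M \<Longrightarrow> B \<in> sets M \<Longrightarrow> A \<inter> B = {} \<Longrightarrow> f (A \<union> B) = f A + f B"
  obtains N where "sets N = sets M" "\<And>A. A \<in> sets M \<Longrightarrow> emeasure N A = ennreal (f A)"
proof -
  interpret finite_measure M by fact
  have [simp]: "f {} = 0" using nonneg[of "{}"] dom[of "{}"] by simp
  have pos: "positive (sets M) (\<lambda>A. ennreal (f A))" by (simp add: positive_def)
  have "countably_additive (sets M) (\<lambda>A. ennreal (f A))"
  proof (rule sets.empty_continuous_imp_countably_additive[OF pos])
    show "additive (sets M) (\<lambda>A. ennreal (f A))"
      using add nonneg by (auto simp: additive_def)
    fix A :: "nat \<Rightarrow> 'a set"
    assume A: "range A \<subseteq> sets M" "decseq A" "(\<Inter>i. A i) = {}"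
    have "(\<lambda>i. measure M (A i)) \<longlonglongrightarrow> 0"
      using finite_Lim_measure_decseq[OF A(1,2)] A(3) by simp
    then have "(\<lambda>i. f (A i)) \<longlonglongrightarrow> 0"
      using A(1) by (rule_tac tendsto_sandwich[OF _ _ tendsto_const])
        (auto intro!: always_eventually nonneg dom)
    then show "(\<lambda>i. ennreal (f (A i))) \<longlonglongrightarrow> 0"
      using tendsto_ennrealI by fastforce
  qed simp
  then have ms: "measure_space (space M) (sets M) (\<lambda>A. ennreal (f A))"
    using pos by (simp add: measure_space_def sets.sigma_algebra_axioms)
  show thesis
  proof
    show "sets (measure_of (space M) (sets M) (\<lambda>A. ennreal (f A))) = sets M" by simp
    show "emeasure (measure_of (space M) (sets M) (\<lambda>A. ennreal (f A))) A = ennreal (f A)"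
      if "A \<in> sets M" for A
      using ms that by (intro emeasure_measure_of_sigma) (auto simp: measure_space_def)
  qed
qed

text \<open>The difficulty is to choose the densities of \<open>m\<close> in the first variable
  coherently in \<open>B\<close>. Additivity and compact approximation are imposed on countable
  algebras outside one null set, and Caratheodory's theorem then produces the measures of the
  kernel. Topology enters through the second factor only; the first is an abstract probability
  space.\<close>

theorem bimeasure_disintegration:
  fixes \<eta> :: "'a measure" and \<nu> :: "'b::polish_space measure"
    and m :: "'a set \<Rightarrow> 'b set \<Rightarrow> real"
  assumes \<eta>: "prob_space \<eta>" and \<nu>: "prob_space \<nu>" "sets \<nu> = sets borel"
    and nonneg: "\<And>A B. A \<in> sets \<eta> \<Longrightarrow> B \<in> sets borel \<Longrightarrow> 0 \<le> m A B"
    and add1: "\<And>A A' B. A \<in> sets \<eta> \<Longrightarrow> A' \<in> sets \<eta> \<Longrightarrow> A \<inter> A' = {} \<Longrightarrow> B \<in> sets borel \<Longrightarrow>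
      m (A \<union> A') B = m A B + m A' B"
    and add2: "\<And>A B B'. A \<in> sets \<eta> \<Longrightarrow> B \<in> sets borel \<Longrightarrow> B' \<in> sets borel \<Longrightarrow> B \<inter> B' = {} \<Longrightarrow>
      m A (B \<union> B') = m A B + m A B'"
    and marg1: "\<And>A. A \<in> sets \<eta> \<Longrightarrow> m A UNIV = measure \<eta> A"
    and marg2: "\<And>B. B \<in> sets borel \<Longrightarrow> m (space \<eta>) B = measure \<nu> B"
  obtains \<Theta> where "\<Theta> \<in> \<eta> \<rightarrow>\<^sub>M prob_algebra borel"
    "\<And>A B. A \<in> sets \<eta> \<Longrightarrow> B \<in> sets borel \<Longrightarrow>
      (\<integral>\<^sup>+x\<in>A. emeasure (\<Theta> x) B \<partial>\<eta>) = ennreal (m A B)"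
proof -
  interpret \<eta>: prob_space \<eta> by fact
  interpret \<nu>: prob_space \<nu> by fact
  have sp\<nu>: "space \<nu> = UNIV" using \<nu>(2) sets_eq_imp_space_eq by fastforce
  have le1: "m A B \<le> measure \<eta> A" if "A \<in> sets \<eta>" "B \<in> sets borel" for A B
  proof -
    have "m A UNIV = m A B + m A (- B)"
      using add2[of A B "- B"] that by (simp add: borel_comp)
    then show ?thesis using nonneg[of A "- B"] marg1[of A] that by (simp add: borel_comp)
  qed
  have le2: "m A B \<le> measure \<nu> B" if "A \<in> sets \<eta>" "B \<in> sets borel" for A B
  proof -
    have "m (space \<eta>) B = m A B + m (space \<eta> - A) B"
      using add1[of A "space \<eta> - A" B] that sets.sets_into_space[OF that(1)]
      by (simp add: Un_absorb1)
    then show ?thesis using nonneg[of "space \<eta> - A" B] marg2[of B] that by simp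
  qed
  have "\<exists>h\<in>borel_measurable \<eta>. \<forall>A\<in>sets \<eta>. (\<integral>\<^sup>+x\<in>A. h x \<partial>\<eta>) = ennreal (m A B)"
    if B: "B \<in> sets borel" for B
  proof -
    obtain N where N: "sets N = sets \<eta>" "\<And>A. A \<in> sets \<eta> \<Longrightarrow> emeasure N A = ennreal (m A B)"
      by (rule measure_of_dominated_additive[of \<eta> "\<lambda>A. m A B"])
        (use nonneg le1 add1 B \<eta>.finite_measure_axioms in auto)
    have "absolutely_continuous \<eta> N"
      unfolding absolutely_continuous_def
    proof
      fix A assume A: "A \<in> null_sets \<eta>"
      then have "m A B \<le> 0"
        using le1[of A B] B by (auto simp: \<eta>.emeasure_eq_measure null_sets_def)
      then show "A \<in> null_sets N" using A N by (auto simp: null_sets_def ennreal_eq_0_iff)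
    qed
    then obtain h where h: "h \<in> borel_measurable \<eta>" "density \<eta> h = N"
      using \<eta>.Radon_Nikodym N(1) by blast
    then have "(\<integral>\<^sup>+x\<in>A. h x \<partial>\<eta>) = ennreal (m A B)" if "A \<in> sets \<eta>" for A
      using N(2)[OF that] that emeasure_density by metis
    then show ?thesis using h by blast
  qed
  \<comment> \<open>The densities are chosen independently for each \<open>B\<close>, so any
    relation between them holds only almost everywhere, and only countably many such relations can
    be used together.\<close>
  then have "\<exists>h. \<forall>B\<in>sets borel. h B \<in> borel_measurable \<eta> \<and>
      (\<forall>A\<in>sets \<eta>. (\<integral>\<^sup>+x\<in>A. h B x \<partial>\<eta>) = ennreal (m A B))"
    by (intro bchoice ballI) blast
  then obtain h where h[measurable]: "\<And>B. B \<in> sets borel \<Longrightarrow> h B \<in> borel_measurable \<eta>"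
    and hm: "\<And>A B. B \<in> sets borel \<Longrightarrow> A \<in> sets \<eta> \<Longrightarrow> (\<integral>\<^sup>+x\<in>A. h B x \<partial>\<eta>) = ennreal (m A B)"
    by blast
  have [measurable]: "B \<in> sets borel \<Longrightarrow> B \<in> sets \<nu>" for B using \<nu>(2) by simp
  obtain \<B> :: "'b set set" where \<B>: "countable \<B>" "topological_basis \<B>"
    using ex_countable_basis by blast
  obtain \<A>0 where \<A>0: "countable \<A>0" "\<B> \<subseteq> \<A>0" "algebra UNIV \<A>0" and b0: "\<A>0 \<subseteq> sets borel"
  proof -
    obtain \<A> where A: "countable \<A>" "\<B> \<subseteq> \<A>" "algebra UNIV \<A>"
      using countable_algebra_extension[OF \<B>(1)] by blast
    interpret A: algebra UNIV \<A> by fact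
    \<comment> \<open>Intersecting with the Borel sets keeps countability and the algebra property,
      and makes all members Borel without an induction over the closure.\<close>
    have "algebra UNIV (\<A> \<inter> sets borel)"
      unfolding algebra_iff_Un using A.compl_sets by (auto simp: borel_comp Compl_eq_Diff_UNIV[symmetric])
    moreover have "\<B> \<subseteq> \<A> \<inter> sets borel"
      using A(2) topological_basis_open[OF \<B>(2)] by auto
    ultimately show thesis using that[of "\<A> \<inter> sets borel"] A(1) by auto
  qed
  have gen0: "sigma_sets UNIV \<A>0 = sets borel"
  proof (rule antisym)
    show "sigma_sets UNIV \<A>0 \<subseteq> sets borel"
      using sets.sigma_sets_subset[of \<A>0 borel] b0 by simp
    have "sets (borel :: 'b measure) = sigma_sets UNIV \<B>"
      unfolding borel_eq_countable_basis[OF \<B>] by (rule sets_measure_of) simp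
    also have "\<dots> \<subseteq> sigma_sets UNIV \<A>0" using \<A>0(2) by (rule sigma_sets_mono')
    finally show "sets borel \<subseteq> sigma_sets UNIV \<A>0" .
  qed
  have "\<exists>K. compact K \<and> K \<subseteq> B \<and> measure \<nu> (B - K) < 1 / real (Suc n)" if "B \<in> sets borel" for B n
  proof -
    have "\<exists>K\<in>{K. K \<subseteq> B \<and> compact K}. emeasure \<nu> B < emeasure \<nu> K + ennreal (1 / real (Suc n))"
    proof (rule SUP_approx_ennreal)
      show "emeasure \<nu> B = (SUP K \<in> {K. K \<subseteq> B \<and> compact K}. emeasure \<nu> K)"
        using that \<nu> by (intro inner_regular) auto
    qed auto
    then obtain K where K: "K \<subseteq> B" "compact K" "emeasure \<nu> B < emeasure \<nu> K + ennreal (1 / real (Suc n))"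
      by blast
    have [measurable]: "K \<in> sets \<nu>" using K(2) \<nu>(2) by (simp add: compact_imp_closed)
    have "ennreal (measure \<nu> B) < ennreal (measure \<nu> K + 1 / real (Suc n))"
      using K(3) by (subst ennreal_plus) (auto simp: \<nu>.emeasure_eq_measure)
    then have "measure \<nu> B < measure \<nu> K + 1 / real (Suc n)"
      by (subst (asm) ennreal_less_iff) auto
    then show ?thesis
      using K that \<nu>(2) by (auto intro!: exI[of _ K] simp: \<nu>.finite_measure_Diff)
  qed
  then have "\<exists>K. B \<in> sets borel \<longrightarrow> compact K \<and> K \<subseteq> B \<and> measure \<nu> (B - K) < 1 / real (Suc n)" for B n
    by blast
  then have "\<exists>K. \<forall>B n. B \<in> sets borel \<longrightarrow>
      compact (K B n) \<and> K B n \<subseteq> B \<and> measure \<nu> (B - K B n) < 1 / real (Suc n)"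
    by (intro choice allI)
  then obtain K where K: "\<And>B n. B \<in> sets borel \<Longrightarrow> compact (K B n)"
    "\<And>B n. B \<in> sets borel \<Longrightarrow> K B n \<subseteq> B"
    "\<And>B n. B \<in> sets borel \<Longrightarrow> measure \<nu> (B - K B n) < 1 / real (Suc n)"
    by blast
  have Kb[measurable]: "K B n \<in> sets borel" if "B \<in> sets borel" for B n
    using K(1)[OF that] by (simp add: compact_imp_closed)
  \<comment> \<open>The sets \<open>B - K B n\<close> with \<open>B\<close> in \<open>\<A>0\<close>
    now belong to a countable algebra, so almost sure additivity covers them as well.\<close>
  obtain \<A>1 where \<A>1: "countable \<A>1" "\<A>0 \<union> (\<Union>n. (\<lambda>B. K B n) ` \<A>0) \<subseteq> \<A>1" "algebra UNIV \<A>1"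
    and b1: "\<A>1 \<subseteq> sets borel"
  proof -
    obtain \<A> where A: "countable \<A>" "\<A>0 \<union> (\<Union>n. (\<lambda>B. K B n) ` \<A>0) \<subseteq> \<A>" "algebra UNIV \<A>"
      by (rule countable_algebra_extension[of "\<A>0 \<union> (\<Union>n. (\<lambda>B. K B n) ` \<A>0)"])
        (use \<A>0(1) in auto)
    interpret A: algebra UNIV \<A> by fact
    have "algebra UNIV (\<A> \<inter> sets borel)"
      unfolding algebra_iff_Un using A.compl_sets by (auto simp: borel_comp Compl_eq_Diff_UNIV[symmetric])
    moreover have "\<A>0 \<union> (\<Union>n. (\<lambda>B. K B n) ` \<A>0) \<subseteq> \<A> \<inter> sets borel"
      using A(2) b0 Kb by auto
    ultimately show thesis using that[of "\<A> \<inter> sets borel"] A(1) by auto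
  qed
  have ae_add: "AE x in \<eta>. h (B \<union> C) x = h B x + h C x"
    if "B \<in> sets borel" "C \<in> sets borel" "B \<inter> C = {}" for B C
  proof (rule \<eta>.density_unique2)
    fix A assume A[measurable]: "A \<in> sets \<eta>"
    note [measurable] = that(1,2)
    have "(\<integral>\<^sup>+x\<in>A. (h B x + h C x) \<partial>\<eta>) = (\<integral>\<^sup>+x\<in>A. h B x \<partial>\<eta>) + (\<integral>\<^sup>+x\<in>A. h C x \<partial>\<eta>)"
      by (simp add: distrib_right nn_integral_add)
    also have "\<dots> = ennreal (m A (B \<union> C))"
      using that A by (simp add: hm add2 nonneg)
    finally show "(\<integral>\<^sup>+x\<in>A. h (B \<union> C) x \<partial>\<eta>) = (\<integral>\<^sup>+x\<in>A. (h B x + h C x) \<partial>\<eta>)"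
      using that A by (simp add: hm)
  qed (use that in measurable)
  have ae_empty: "AE x in \<eta>. h {} x = 0"
  proof (rule \<eta>.density_unique2)
    fix A assume A: "A \<in> sets \<eta>"
    have "m A {} = 0" using add2[OF A, of "{}" "{}"] by simp
    then show "(\<integral>\<^sup>+x\<in>A. h {} x \<partial>\<eta>) = (\<integral>\<^sup>+x\<in>A. 0 \<partial>\<eta>)" using A by (simp add: hm)
  qed simp_all
  have ae_UNIV: "AE x in \<eta>. h UNIV x = 1"
  proof (rule \<eta>.density_unique2)
    fix A assume A: "A \<in> sets \<eta>"
    then show "(\<integral>\<^sup>+x\<in>A. h UNIV x \<partial>\<eta>) = (\<integral>\<^sup>+x\<in>A. 1 \<partial>\<eta>)"
      by (simp add: hm marg1 \<eta>.emeasure_eq_measure)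
  qed simp_all
  \<comment> \<open>The integral of \<open>h (B - K B n)\<close> is the \<nu>-mass of
    \<open>B - K B n\<close> and tends to 0. This bounds the integral of the infimum by 0; a
    vanishing infimum is all that the choice of a good compact subset at a given point
    requires.\<close>
  have ae_K: "AE x in \<eta>. (INF n. h (B - K B n) x) = 0" if B[measurable]: "B \<in> sets borel" for B
  proof -
    have "(\<integral>\<^sup>+x. (INF n. h (B - K B n) x) \<partial>\<eta>) \<le> ennreal (1 / real (Suc n))" for n
    proof -
      have "(\<integral>\<^sup>+x. (INF n. h (B - K B n) x) \<partial>\<eta>) \<le> (\<integral>\<^sup>+x\<in>space \<eta>. h (B - K B n) x \<partial>\<eta>)"
        by (intro nn_integral_mono) (auto intro: INF_lower)
      also have "\<dots> = ennreal (measure \<nu> (B - K B n))"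
        using B Kb[OF B] by (subst hm) (simp_all add: marg2)
      also have "\<dots> \<le> ennreal (1 / real (Suc n))"
        using K(3)[OF B] by (intro ennreal_leI less_imp_le)
      finally show ?thesis .
    qed
    moreover have "(\<lambda>n. ennreal (1 / real (Suc n))) \<longlonglongrightarrow> 0"
      using tendsto_ennrealI[OF LIMSEQ_Suc[OF lim_1_over_n]] by simp
    ultimately have "(\<integral>\<^sup>+x. (INF n. h (B - K B n) x) \<partial>\<eta>) \<le> 0"
      by (intro LIMSEQ_le_const) auto
    then show ?thesis by (subst (asm) le_zero_eq, subst (asm) nn_integral_0_iff_AE) auto
  qed
  have "AE x in \<eta>. (\<forall>B\<in>\<A>1. \<forall>C\<in>\<A>1. B \<inter> C = {} \<longrightarrow> h (B \<union> C) x = h B x + h C x) \<and>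
    h {} x = 0 \<and> h UNIV x = 1 \<and> (\<forall>B\<in>\<A>0. (INF n. h (B - K B n) x) = 0)"
  proof (intro AE_conjI ae_empty ae_UNIV)
    show "AE x in \<eta>. \<forall>B\<in>\<A>1. \<forall>C\<in>\<A>1. B \<inter> C = {} \<longrightarrow> h (B \<union> C) x = h B x + h C x"
      using \<A>1(1) b1 ae_add by (auto simp: AE_ball_countable subset_eq)
    show "AE x in \<eta>. \<forall>B\<in>\<A>0. (INF n. h (B - K B n) x) = 0"
      using \<A>0(1) b0 ae_K by (auto simp: AE_ball_countable)
  qed
  then obtain Z where Zc: "\<And>x. x \<in> space \<eta> - Z \<Longrightarrow>
      (\<forall>B\<in>\<A>1. \<forall>C\<in>\<A>1. B \<inter> C = {} \<longrightarrow> h (B \<union> C) x = h B x + h C x) \<and>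
      h {} x = 0 \<and> h UNIV x = 1 \<and> (\<forall>B\<in>\<A>0. (INF n. h (B - K B n) x) = 0)"
    and Z: "Z \<in> null_sets \<eta>"
    by (rule AE_E3) (rule that)
  have [measurable]: "Z \<in> sets \<eta>" using Z by auto
  have "\<exists>M. prob_space M \<and> sets M = sets borel \<and> (\<forall>B\<in>\<A>0. emeasure M B = h B x)"
    if x: "x \<in> space \<eta> - Z" for x
  proof (rule prob_extension_of_compact_approx[OF \<A>0(3) \<A>1(3) _ gen0])
    show "\<exists>L\<in>\<A>1. compact L \<and> L \<subseteq> B \<and> h (B - L) x < ennreal e" if "B \<in> \<A>0" "0 < e" for B e
    proof -
      have "(INF n. h (B - K B n) x) < ennreal e" using Zc[OF x] that by simp
      then obtain n where "h (B - K B n) x < ennreal e" by (auto simp: INF_less_iff)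
      moreover have "K B n \<in> \<A>1" using \<A>1(2) that(1) by blast
      ultimately show ?thesis
        using K(1,2)[of B n] b0 that(1) by (intro bexI[of _ "K B n"]) auto
    qed
  qed (use Zc[OF x] \<A>1(2) in auto)
  \<comment> \<open>On the exceptional null set the kernel takes the constant value
    \<open>\<nu>\<close>: it is then a Borel probability at every point and remains measurable, and
    integrals against \<open>\<eta>\<close> are not affected.\<close>
  then have "\<exists>M. prob_space M \<and> sets M = sets borel \<and>
      (if x \<in> Z then M = \<nu> else \<forall>B\<in>\<A>0. emeasure M B = h B x)" if "x \<in> space \<eta>" for x
    using \<nu> that by (cases "x \<in> Z") auto
  then have "\<exists>\<Theta>. \<forall>x\<in>space \<eta>. prob_space (\<Theta> x) \<and> sets (\<Theta> x) = sets borel \<and>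
      (if x \<in> Z then \<Theta> x = \<nu> else \<forall>B\<in>\<A>0. emeasure (\<Theta> x) B = h B x)"
    by (intro bchoice ballI)
  then obtain \<Theta> where \<Theta>: "\<And>x. x \<in> space \<eta> \<Longrightarrow> prob_space (\<Theta> x)"
    "\<And>x. x \<in> space \<eta> \<Longrightarrow> sets (\<Theta> x) = sets borel"
    "\<And>x. x \<in> space \<eta> \<Longrightarrow> if x \<in> Z then \<Theta> x = \<nu> else \<forall>B\<in>\<A>0. emeasure (\<Theta> x) B = h B x"
    by blast
  have e\<Theta>: "emeasure (\<Theta> x) B = (if x \<in> Z then emeasure \<nu> B else h B x)"
    if "x \<in> space \<eta>" "B \<in> \<A>0" for x B using \<Theta>(3)[OF that(1)] that(2) by (auto split: if_splits)
  interpret A0: algebra UNIV \<A>0 by fact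
  have Int: "Int_stable \<A>0" by (auto intro: Int_stableI)
  have meas: "\<Theta> \<in> \<eta> \<rightarrow>\<^sub>M prob_algebra borel"
  proof (rule measurable_prob_algebra_generated[OF gen0[symmetric] Int])
    fix B assume B: "B \<in> \<A>0"
    then have [measurable]: "B \<in> sets borel" using b0 by blast
    have "(\<lambda>x. if x \<in> Z then emeasure \<nu> B else h B x) \<in> borel_measurable \<eta>" by measurable
    then show "(\<lambda>x. emeasure (\<Theta> x) B) \<in> borel_measurable \<eta>"
      using e\<Theta> B by (simp cong: measurable_cong)
  qed (use \<Theta> in auto)
  have sm: "\<Theta> \<in> \<eta> \<rightarrow>\<^sub>M subprob_algebra borel" by (rule measurable_prob_algebraD[OF meas])
  show thesis
  proof
    show "\<Theta> \<in> \<eta> \<rightarrow>\<^sub>M prob_algebra borel" by fact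
    fix A and B :: "'b set" assume A[measurable]: "A \<in> sets \<eta>" and B: "B \<in> sets borel"
    obtain N where N: "sets N = sets borel" "\<And>B. B \<in> sets borel \<Longrightarrow> emeasure N B = ennreal (m A B)"
      by (rule measure_of_dominated_additive[of \<nu> "\<lambda>B. m A B"])
        (use nonneg le2 add2 A \<nu> \<nu>.finite_measure_axioms in auto)
    \<comment> \<open>The identity is known only for \<open>B\<close> in \<open>\<A>0\<close>, where
      the kernel equals the density. For fixed \<open>A\<close> both sides are finite measures in
      \<open>B\<close>: the left one is the kernel averaged over \<open>A\<close>, the right one a
      section dominated by \<open>\<nu>\<close>. Agreement on the generating algebra makes them
      equal.\<close>
    define L where "L = density \<eta> (indicator A) \<bind> \<Theta>"
    have sm': "\<Theta> \<in> density \<eta> (indicator A) \<rightarrow>\<^sub>M subprob_algebra borel"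
      using sm by (simp cong: measurable_cong_sets)
    have borel_UNIV: "UNIV \<in> sets (borel :: 'b measure)" by simp
    have ne: "space (density \<eta> (indicator A)) \<noteq> {}" using \<eta>.not_empty by simp
    have L: "emeasure L B = (\<integral>\<^sup>+x\<in>A. emeasure (\<Theta> x) B \<partial>\<eta>)" if "B \<in> sets borel" for B
    proof -
      have [measurable]: "(\<lambda>x. emeasure (\<Theta> x) B) \<in> borel_measurable \<eta>"
        using sm that by (rule measurable_emeasure_kernel)
      show ?thesis unfolding L_def
        by (subst emeasure_bind[OF ne sm' that], subst nn_integral_density) (auto simp: mult.commute)
    qed
    have "L = N"
    proof (rule measure_eqI_generator_eq[OF Int, where A = "\<lambda>_. UNIV" and \<Omega> = UNIV])
      show "sets L = sigma_sets UNIV \<A>0" unfolding L_def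
        by (subst sets_bind[OF sets_kernel[OF sm'] ne]) (auto simp: gen0)
      show "sets N = sigma_sets UNIV \<A>0" using N gen0 by simp
      fix B assume B: "B \<in> \<A>0"
      then have Bb: "B \<in> sets borel" using b0 by blast
      have "AE x in \<eta>. emeasure (\<Theta> x) B * indicator A x = h B x * indicator A x"
        using AE_not_in[OF Z] AE_space by eventually_elim (use e\<Theta> B in auto)
      then have "(\<integral>\<^sup>+x\<in>A. emeasure (\<Theta> x) B \<partial>\<eta>) = (\<integral>\<^sup>+x\<in>A. h B x \<partial>\<eta>)"
        by (rule nn_integral_cong_AE)
      then show "emeasure L B = emeasure N B" using L N(2) hm A Bb by simp
    next
      have "emeasure L UNIV \<le> (\<integral>\<^sup>+x. 1 \<partial>\<eta>)"
        unfolding L[OF borel_UNIV]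
        by (intro nn_integral_mono) (auto intro!: prob_space.emeasure_le_1 \<Theta>(1) split: split_indicator)
      then show "emeasure L UNIV \<noteq> \<infinity>" by (auto simp: \<eta>.emeasure_space_1 top_unique)
    qed (use A0.top in auto)
    then show "(\<integral>\<^sup>+x\<in>A. emeasure (\<Theta> x) B \<partial>\<eta>) = ennreal (m A B)"
      using L[OF B] N(2)[OF B] by simp
  qed
qed

section \<open>Convergence on rectangles\<close>

text \<open>The index type may be uncountable, and the cube is then compact but not necessarily
  sequentially compact; hence a filter finer than \<open>sequentially\<close> replaces a
  subsequence.\<close>

lemma pointwise_cluster_filter:
  fixes g :: "nat \<Rightarrow> 'i \<Rightarrow> real"
  assumes "\<And>n i. g n i \<in> {0..1}"
  obtains G m where "G \<noteq> bot" "G \<le> sequentially" "\<And>i. ((\<lambda>n. g n i) \<longlongrightarrow> m i) G"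
proof -
  have "compactin (product_topology (\<lambda>i. euclidean) UNIV) (PiE (UNIV :: 'i set) (\<lambda>_. {0..1 :: real}))"
    by (simp add: compactin_PiE compactin_euclidean_iff)
  then have "compact (PiE (UNIV :: 'i set) (\<lambda>_. {0..1 :: real}))"
    by (simp add: euclidean_product_topology)
  moreover have "filtermap g sequentially \<noteq> bot" by (simp add: filtermap_bot_iff)
  moreover have "eventually (\<lambda>f. f \<in> PiE UNIV (\<lambda>_. {0..1})) (filtermap g sequentially)"
    using assms by (auto simp: eventually_filtermap PiE_def)
  ultimately obtain m where m: "inf (nhds m) (filtermap g sequentially) \<noteq> bot"
    unfolding compact_filter by blast
  define G where "G = inf sequentially (filtercomap g (nhds m))"
  show thesis
  proof
    \<comment> \<open>If \<open>G\<close> were trivial, some neighbourhood of \<open>m\<close> would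
      eventually be avoided by the sequence, and \<open>m\<close> would not be a cluster
      point.\<close>
    show "G \<noteq> bot"
    proof
      assume "G = bot"
      then have "eventually (\<lambda>_. False) G" by simp
      then obtain P Q where PQ: "eventually P sequentially" "eventually Q (nhds m)"
        "\<And>n. P n \<Longrightarrow> Q (g n) \<Longrightarrow> False"
        unfolding G_def eventually_inf eventually_filtercomap by blast
      have "eventually (\<lambda>f. \<not> Q f) (filtermap g sequentially)"
        unfolding eventually_filtermap using PQ(1) by eventually_elim (use PQ(3) in blast)
      then have "eventually (\<lambda>_. False) (inf (nhds m) (filtermap g sequentially))"
        unfolding eventually_inf using PQ(2) by blast
      then show False using m by (simp add: trivial_limit_def)
    qed
    show "G \<le> sequentially" by (simp add: G_def)
    fix i
    have "filterlim g (nhds m) G"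
      unfolding G_def by (intro filterlim_mono[OF filterlim_filtercomap]) auto
    then show "((\<lambda>n. g n i) \<longlongrightarrow> m i) G"
      by (rule continuous_on_tendsto_compose[OF continuous_on_product_coordinates]) auto
  qed
qed

text \<open>Inclusion-exclusion in recursive form. Splitting off one set \<open>X\<close> leaves the
  other sets and their traces on \<open>X\<close>; both families have fewer members, coinciding
  traces only helping, and stability under intersection keeps the traces in \<open>R\<close>.
  Induction on the cardinality applies to both.\<close>

lemma tendsto_measure_Union:
  assumes fin: "\<And>n. finite_measure (\<mu> n)" "finite_measure \<gamma>"
    and sets: "\<And>n. R \<subseteq> sets (\<mu> n)" "R \<subseteq> sets \<gamma>"
    and Int: "Int_stable R"
    and lim: "\<And>X. X \<in> R \<Longrightarrow> ((\<lambda>n. measure (\<mu> n) X) \<longlongrightarrow> measure \<gamma> X) G"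
    and S: "finite S" "S \<subseteq> R"
  shows "((\<lambda>n. measure (\<mu> n) (\<Union>S)) \<longlongrightarrow> measure \<gamma> (\<Union>S)) G"
  using S
proof (induction "card S" arbitrary: S rule: less_induct)
  case (less S)
  show ?case
  proof (cases "S = {}")
    case False
    then obtain X where X: "X \<in> S" by blast
    define T where "T = S - {X}"
    define T' where "T' = (\<lambda>Y. X \<inter> Y) ` T"
    have T: "finite T" "T \<subseteq> R" "card T < card S"
      using less.prems X card_Diff1_less[of S X] by (auto simp: T_def)
    have T': "finite T'" "T' \<subseteq> R" "card T' < card S"
      using T X less.prems Int card_image_le[OF T(1), of "\<lambda>Y. X \<inter> Y"]
      by (auto simp: T'_def Int_stable_def)
    have eq: "measure \<rho> (\<Union>S) = measure \<rho> X + measure \<rho> (\<Union>T) - measure \<rho> (\<Union>T')"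
      if "finite_measure \<rho>" "R \<subseteq> sets \<rho>" for \<rho>
    proof -
      interpret finite_measure \<rho> by fact
      have [simp]: "X \<in> sets \<rho>" "\<Union>T \<in> sets \<rho>"
        using that(2) X less.prems T by (auto intro!: sets.finite_Union)
      have [simp]: "\<Union>T' \<in> sets \<rho>"
        using that(2) T' by (auto intro!: sets.finite_Union)
      have "\<Union>S = X \<union> (\<Union>T - \<Union>T')" "X \<inter> \<Union>T = \<Union>T'" using X by (auto simp: T_def T'_def)
      then have "measure \<rho> (\<Union>S) = measure \<rho> X + measure \<rho> (\<Union>T - X \<inter> \<Union>T)"
        by (subst finite_measure_Union[symmetric]) (auto intro: arg_cong[where f = "measure \<rho>"])
      also have "\<dots> = measure \<rho> X + (measure \<rho> (\<Union>T) - measure \<rho> (X \<inter> \<Union>T))"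
        by (subst finite_measure_Diff) auto
      finally show ?thesis using \<open>X \<inter> \<Union>T = \<Union>T'\<close> by simp
    qed
    have "((\<lambda>n. measure (\<mu> n) X + measure (\<mu> n) (\<Union>T) - measure (\<mu> n) (\<Union>T')) \<longlongrightarrow>
        measure \<gamma> X + measure \<gamma> (\<Union>T) - measure \<gamma> (\<Union>T')) G"
      using X less.prems by (intro tendsto_intros lim less.hyps T T') auto
    then show ?thesis using eq fin sets by simp
  qed simp
qed

text \<open>Products of members of two countable bases form a countable basis; the basis members
  that make up \<open>U\<close> are enumerated and partial unions are taken.\<close>

lemma open_prod_incseq_rectangles:
  fixes U :: "('a::second_countable_topology \<times> 'b::second_countable_topology) set"
  assumes "open U"
  obtains S where "\<And>l :: nat. finite (S l)" "\<And>l. S l \<subseteq> {A \<times> B |A B. open A \<and> open B}"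
    "incseq (\<lambda>l. \<Union>(S l))" "(\<Union>l. \<Union>(S l)) = U"
proof -
  obtain \<A> :: "'a set set" where \<A>: "countable \<A>" "topological_basis \<A>"
    using ex_countable_basis by blast
  obtain \<B> :: "'b set set" where \<B>: "countable \<B>" "topological_basis \<B>"
    using ex_countable_basis by blast
  define \<C> where "\<C> = (\<lambda>(a, b). a \<times> b) ` (\<A> \<times> \<B>)"
  have \<C>: "countable \<C>" "topological_basis \<C>"
    using \<A> \<B> by (auto simp: \<C>_def intro: topological_basis_prod)
  have op: "\<C> \<subseteq> {A \<times> B |A B. open A \<and> open B}"
    using topological_basis_open[OF \<A>(2)] topological_basis_open[OF \<B>(2)] by (auto simp: \<C>_def)
  obtain \<D> where \<D>: "\<D> \<subseteq> \<C>" "\<Union>\<D> = U"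
    using \<C>(2) assms unfolding topological_basis_def by blast
  \<comment> \<open>\<open>from_nat_into\<close> enumerates nonempty countable sets; adding the
    empty rectangle covers the case of an empty family.\<close>
  define S where "S l = from_nat_into (insert {} \<D>) ` {..<l}" for l :: nat
  have cD: "countable (insert {} \<D>)" using \<C>(1) \<D>(1) countable_subset by auto
  show thesis
  proof
    show "finite (S l)" for l by (simp add: S_def)
    have "S l \<subseteq> insert {} \<D>" for l
      using from_nat_into[of "insert {} \<D>"] by (auto simp: S_def)
    moreover have "{} \<in> {A \<times> B |A B. open A \<and> open B}" by blast
    ultimately show "S l \<subseteq> {A \<times> B |A B. open A \<and> open B}" for l
      using op \<D>(1) by blast
    show "incseq (\<lambda>l. \<Union>(S l))"
      unfolding incseq_def S_def by (intro allI impI Union_mono image_mono) auto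
    have "(\<Union>l. S l) = range (from_nat_into (insert {} \<D>))" by (auto simp: S_def)
    also have "\<dots> = insert {} \<D>" by (rule range_from_nat_into) (use cD in auto)
    finally have "\<Union>(\<Union>l. S l) = U" using \<D>(2) by simp
    then show "(\<Union>l. \<Union>(S l)) = U" by blast
  qed
qed

text \<open>A lower Riemann sum of the layer-cake formula, x being the integral over t > 0 of the
  indicator of t < x, with mesh 1/2^k on the interval from 0 to 2^k; this gives 4^k levels. The
  strict inequality turns the level sets of a lower semicontinuous function into open sets.\<close>

definition layer_sum :: "nat \<Rightarrow> ennreal \<Rightarrow> ennreal" where
  "layer_sum k x = (\<Sum>j\<in>{1..4^k}. ennreal (1 / 2^k) * indicator {y. ennreal (real j / 2^k) < y} x)"

lemma layer_sum_eq_card: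
  "layer_sum k x = ennreal (real (card {j\<in>{1..4^k}. ennreal (real j / 2^k) < x}) / 2^k)"
proof -
  define J where "J = {j\<in>{1..4^k}. ennreal (real j / 2^k) < x}"
  have "layer_sum k x = (\<Sum>j\<in>{1..4^k}. if ennreal (real j / 2^k) < x then ennreal (1 / 2^k) else 0)"
    unfolding layer_sum_def by (intro sum.cong) (auto simp: indicator_def)
  also have "\<dots> = (\<Sum>j\<in>J. ennreal (1 / 2^k))"
    unfolding J_def by (rule sum.inter_filter[symmetric]) simp
  also have "\<dots> = ennreal (real (card J) * (1 / 2^k))"
    by (simp add: ennreal_of_nat_eq_real_of_nat ennreal_mult[symmetric])
  finally show ?thesis by (simp add: J_def)
qed

lemma layer_sum_le: "layer_sum k x \<le> x"
proof (cases x)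
  case (real r)
  \<comment> \<open>The levels start at \<open>j = 1\<close>, so no more than the integer part of r
    * 2^k of them lie below r.\<close>
  have "{j\<in>{1..4^k}. ennreal (real j / 2^k) < x} \<subseteq> {1..nat \<lfloor>r * 2^k\<rfloor>}"
    using real by (auto simp: ennreal_less_iff divide_less_eq le_nat_floor less_imp_le)
  then have "card {j\<in>{1..4^k}. ennreal (real j / 2^k) < x} \<le> nat \<lfloor>r * 2^k\<rfloor>"
    using card_mono[of "{1..nat \<lfloor>r * 2^k\<rfloor>}"] by fastforce
  then have "real (card {j\<in>{1..4^k}. ennreal (real j / 2^k) < x}) \<le> real (nat \<lfloor>r * 2^k\<rfloor>)"
    by (rule of_nat_mono)
  also have "\<dots> \<le> r * 2^k" using real by (intro of_nat_floor) simp
  finally show ?thesis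
    using real by (simp add: layer_sum_eq_card ennreal_leI divide_le_eq)
qed simp

text \<open>Below x a real r is fixed, which also covers x infinite. Once 2^k \<ge> r, every level
  up to r is counted, and the sum is at least r - 1/2^k.\<close>

lemma le_liminf_layer_sum: "x \<le> liminf (\<lambda>k. layer_sum k x)"
  unfolding le_Liminf_iff
proof (intro allI impI)
  fix y assume "y < x"
  then obtain z where z: "y < z" "z < x" using dense by blast
  then obtain r where r: "z = ennreal r" "0 \<le> r" by (cases z) auto
  have "(\<lambda>k. ennreal (r - 1 / 2^k)) \<longlonglongrightarrow> ennreal (r - 0)"
    by (intro tendsto_ennrealI tendsto_diff tendsto_const) real_asymp
  then have "eventually (\<lambda>k. y < ennreal (r - 1 / 2^k)) sequentially"
    using z(1) r by (intro order_tendstoD) auto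
  moreover have "eventually (\<lambda>k. r \<le> 2^k) sequentially" by real_asymp
  ultimately show "eventually (\<lambda>k. y < layer_sum k x) sequentially"
  proof eventually_elim
    case (elim k)
    define q where "q = nat \<lfloor>r * 2^k\<rfloor>"
    have q: "real q \<le> r * 2^k" "r * 2^k < real q + 1" 
      using r(2) unfolding q_def by (simp_all add: of_nat_nat)
    have "real q \<le> 4 ^ k"
    proof -
      have "r * 2^k \<le> 2^k * 2^k" using elim(2) by (intro mult_right_mono) auto
      also have "\<dots> = 4 ^ k" by (simp flip: power_mult_distrib)
      finally show ?thesis using q(1) by linarith
    qed
    then have q4: "q \<le> 4 ^ k" using of_nat_le_iff[of q "4^k", where 'a = real] by simp
    have "{1..q} \<subseteq> {j\<in>{1..4^k}. ennreal (real j / 2^k) < x}"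
    proof
      fix j assume j: "j \<in> {1..q}"
      then have "real j / 2^k \<le> r" using q(1) by (simp add: divide_le_eq)
      then have "ennreal (real j / 2^k) < x" using z(2) r(1) ennreal_leI le_less_trans by blast
      then show "j \<in> {j\<in>{1..4^k}. ennreal (real j / 2^k) < x}" using j q4 by auto
    qed
    then have "q \<le> card {j\<in>{1..4^k}. ennreal (real j / 2^k) < x}"
      using card_mono[of "{j\<in>{1..4^k}. ennreal (real j / 2^k) < x}" "{1..q}"] by simp
    then have "r * 2^k - 1 \<le> real (card {j\<in>{1..4^k}. ennreal (real j / 2^k) < x})"
      using q(2) by linarith
    then have "(r * 2^k - 1) / 2^k \<le> real (card {j\<in>{1..4^k}. ennreal (real j / 2^k) < x}) / 2^k"
      by (intro divide_right_mono) auto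
    then have "r - 1 / 2^k \<le> real (card {j\<in>{1..4^k}. ennreal (real j / 2^k) < x}) / 2^k"
      by (simp add: diff_divide_distrib)
    then show ?case using elim(1) by (auto simp: layer_sum_eq_card intro: less_le_trans ennreal_leI)
  qed
qed

text \<open>A portmanteau argument with rectangles in place of continuous test functions. The level
  sets of \<open>c\<close> are open, so each layer sum integrates to a finite combination of masses
  of open sets, and these are exhausted from inside by finite unions of open rectangles, whose
  masses converge.\<close>

lemma lsc_nn_integral_le_limit:
  fixes c :: "'a::second_countable_topology \<times> 'b::second_countable_topology \<Rightarrow> ennreal"
  assumes G: "G \<noteq> bot"
    and \<mu>: "\<And>n. prob_space (\<mu> n)" "\<And>n. sets (\<mu> n) = sets borel"
    and \<gamma>: "prob_space \<gamma>" "sets \<gamma> = sets borel"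
    and lim: "\<And>A B. open A \<Longrightarrow> open B \<Longrightarrow>
      ((\<lambda>n. measure (\<mu> n) (A \<times> B)) \<longlongrightarrow> measure \<gamma> (A \<times> B)) G"
    and c: "lower_semicontinuous c"
    and V: "((\<lambda>n. \<integral>\<^sup>+z. c z \<partial>\<mu> n) \<longlongrightarrow> V) G"
  shows "(\<integral>\<^sup>+z. c z \<partial>\<gamma>) \<le> V"
proof -
  have fm: "finite_measure (\<mu> n)" "finite_measure \<gamma>" for n
    using \<mu>(1) \<gamma>(1) by (auto intro: prob_space.axioms(1))
  define O' where "O' k j = {z. ennreal (real j / 2^k) < c z}" for k j :: nat
  have "open (O' k j)" for k j using c by (simp add: lower_semicontinuous_def O'_def)
  then have Ob: "O' k j \<in> sets borel" for k j by simp
  have Om[measurable]: "O' k j \<in> sets \<gamma>" "O' k j \<in> sets (\<mu> n)" for k j n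
    using Ob \<mu>(2) \<gamma>(2) by auto
  have ls: "layer_sum k (c z) = (\<Sum>j\<in>{1..4^k}. ennreal (1 / 2^k) * indicator (O' k j) z)" for k z
    by (simp add: layer_sum_def O'_def indicator_def)
  have int: "(\<integral>\<^sup>+z. layer_sum k (c z) \<partial>\<rho>) = (\<Sum>j\<in>{1..4^k}. ennreal (1 / 2^k) * emeasure \<rho> (O' k j))"
    if "sets \<rho> = sets borel" for \<rho> k
    unfolding ls using Ob that by (subst nn_integral_sum) (auto simp: nn_integral_cmult)
  have le: "(\<integral>\<^sup>+z. layer_sum k (c z) \<partial>\<gamma>) \<le> V" for k
  proof -
    have "\<exists>S. (\<forall>l :: nat. finite (S l) \<and> S l \<subseteq> {A \<times> B |A B. open A \<and> open B}) \<and>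
        incseq (\<lambda>l. \<Union>(S l)) \<and> (\<Union>l. \<Union>(S l)) = O' k j" for j
      by (rule open_prod_incseq_rectangles[OF \<open>open (O' k j)\<close>]) (rule exI, intro conjI allI)
    then have "\<exists>S. \<forall>j. (\<forall>l :: nat. finite (S j l) \<and> S j l \<subseteq> {A \<times> B |A B. open A \<and> open B}) \<and>
        incseq (\<lambda>l. \<Union>(S j l)) \<and> (\<Union>l. \<Union>(S j l)) = O' k j"
      by (intro choice allI)
    then obtain S :: "nat \<Rightarrow> nat \<Rightarrow> ('a \<times> 'b) set set" where
      S': "\<forall>j. (\<forall>l. finite (S j l) \<and> S j l \<subseteq> {A \<times> B |A B. open A \<and> open B}) \<and>
        incseq (\<lambda>l. \<Union>(S j l)) \<and> (\<Union>l. \<Union>(S j l)) = O' k j" ..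
    have S: "finite (S j l)" "S j l \<subseteq> {A \<times> B |A B. open A \<and> open B}"
        "incseq (\<lambda>l. \<Union>(S j l))" "(\<Union>l. \<Union>(S j l)) = O' k j" for j l
      using S' by simp_all
    have Sop: "open (\<Union>(S j l))" for j l using S(2)[of j l] by (intro open_Union) (auto intro: open_Times)
    then have Sb: "\<Union>(S j l) \<in> sets borel" for j l by simp
    \<comment> \<open>The order of limits matters: with \<open>k\<close> and \<open>l\<close> fixed
      the sum is finite and converges along \<open>G\<close>. Only afterwards \<open>l\<close> tends
      to infinity, by continuity from below, and then \<open>k\<close>, by Fatou's lemma; both are
      ordinary sequences under the fixed measure \<open>\<gamma>\<close>.\<close>
    have bound: "(\<Sum>j\<in>{1..4^k}. ennreal (1 / 2^k) * emeasure \<gamma> (\<Union>(S j l))) \<le> V" for l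
    proof (rule tendsto_le[OF G V])
      have "((\<lambda>n. emeasure (\<mu> n) (\<Union>(S j l))) \<longlongrightarrow> emeasure \<gamma> (\<Union>(S j l))) G" for j
      proof -
        have "((\<lambda>n. measure (\<mu> n) (\<Union>(S j l))) \<longlongrightarrow> measure \<gamma> (\<Union>(S j l))) G"
        proof (rule tendsto_measure_Union[where R = "{A \<times> B |A B. open A \<and> open B}"])
          show "Int_stable {A \<times> B |A B. open (A :: 'a set) \<and> open (B :: 'b set)}"
          proof (rule Int_stableI)
            fix X Y assume "X \<in> {A \<times> B |A B. open (A :: 'a set) \<and> open (B :: 'b set)}"
              "Y \<in> {A \<times> B |A B. open (A :: 'a set) \<and> open (B :: 'b set)}"
            then obtain A B A' B' where "X = A \<times> B" "Y = A' \<times> B'" "open A" "open B" "open A'" "open B'"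
              by auto
            then have "X \<inter> Y = (A \<inter> A') \<times> (B \<inter> B')" "open (A \<inter> A')" "open (B \<inter> B')"
              by (auto simp: Times_Int_Times)
            then show "X \<inter> Y \<in> {A \<times> B |A B. open A \<and> open B}" by blast
          qed
          show "{A \<times> B |A B. open A \<and> open B} \<subseteq> sets (\<mu> n)" for n
            using \<mu>(2) by (auto intro!: borel_open open_Times)
          show "{A \<times> B |A B. open A \<and> open B} \<subseteq> sets \<gamma>"
            using \<gamma>(2) by (auto intro!: borel_open open_Times)
        qed (use fm lim S in auto)
        then show ?thesis
          using fm by (simp add: finite_measure.emeasure_eq_measure tendsto_ennrealI)
      qed
      then show "((\<lambda>n. \<Sum>j\<in>{1..4^k}. ennreal (1 / 2^k) * emeasure (\<mu> n) (\<Union>(S j l))) \<longlongrightarrow>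
          (\<Sum>j\<in>{1..4^k}. ennreal (1 / 2^k) * emeasure \<gamma> (\<Union>(S j l)))) G"
        by (intro tendsto_sum ennreal_tendsto_cmult) auto
      have "(\<Sum>j\<in>{1..4^k}. ennreal (1 / 2^k) * emeasure (\<mu> n) (\<Union>(S j l))) \<le> (\<integral>\<^sup>+z. c z \<partial>\<mu> n)" for n
      proof -
        have "(\<Sum>j\<in>{1..4^k}. ennreal (1 / 2^k) * emeasure (\<mu> n) (\<Union>(S j l))) \<le>
            (\<Sum>j\<in>{1..4^k}. ennreal (1 / 2^k) * emeasure (\<mu> n) (O' k j))"
          using S(4) Om by (intro sum_mono mult_left_mono emeasure_mono) auto
        also have "\<dots> = (\<integral>\<^sup>+z. layer_sum k (c z) \<partial>\<mu> n)" using int \<mu>(2) by simp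
        also have "\<dots> \<le> (\<integral>\<^sup>+z. c z \<partial>\<mu> n)" by (intro nn_integral_mono layer_sum_le)
        finally show ?thesis .
      qed
      then show "eventually (\<lambda>n. (\<Sum>j\<in>{1..4^k}. ennreal (1 / 2^k) * emeasure (\<mu> n) (\<Union>(S j l))) \<le>
          (\<integral>\<^sup>+z. c z \<partial>\<mu> n)) G"
        by simp
    qed
    have "(\<lambda>l. \<Sum>j\<in>{1..4^k}. ennreal (1 / 2^k) * emeasure \<gamma> (\<Union>(S j l))) \<longlonglongrightarrow>
        (\<Sum>j\<in>{1..4^k}. ennreal (1 / 2^k) * emeasure \<gamma> (O' k j))"
    proof (intro tendsto_sum ennreal_tendsto_cmult)
      fix j
      have "range (\<lambda>l. \<Union>(S j l)) \<subseteq> sets \<gamma>" using Sb \<gamma>(2) by auto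
      then show "(\<lambda>l. emeasure \<gamma> (\<Union>(S j l))) \<longlonglongrightarrow> emeasure \<gamma> (O' k j)"
        using Lim_emeasure_incseq[OF _ S(3)[of j]] S(4)[of j] by simp
    qed simp
    then show ?thesis
      unfolding int[OF \<gamma>(2)] using bound by (intro LIMSEQ_le_const2) auto
  qed
  have "(\<integral>\<^sup>+z. c z \<partial>\<gamma>) \<le> (\<integral>\<^sup>+z. liminf (\<lambda>k. layer_sum k (c z)) \<partial>\<gamma>)"
    by (intro nn_integral_mono le_liminf_layer_sum)
  also have "\<dots> \<le> liminf (\<lambda>k. \<integral>\<^sup>+z. layer_sum k (c z) \<partial>\<gamma>)"
    by (rule nn_integral_liminf) (simp add: ls)
  also have "\<dots> \<le> liminf (\<lambda>k::nat. V)" using le by (intro Liminf_mono) auto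
  also have "\<dots> = V" by (simp add: Liminf_const)
  finally show ?thesis .
qed

section \<open>Completed sigma-fields and weak limits\<close>

lemma space_negl_completion [simp]: "space (negl_completion \<eta> G) = space \<eta>"
  by (simp add: negl_completion_def space_measure_of_conv)

lemma negl_completion_sets:
  assumes "subalgebra \<eta> G"
  shows "sets (negl_completion \<eta> G) =
    sigma_sets (space \<eta>) (sets G \<union> {N. \<exists>N'\<in>null_sets \<eta>. N \<subseteq> N'})"
proof -
  have "sets G \<subseteq> Pow (space \<eta>)"
    using assms sets.space_closed[of G] by (simp add: subalgebra_def)
  moreover have "N \<subseteq> space \<eta>" if "N' \<in> null_sets \<eta>" "N \<subseteq> N'" for N N'
    using sets.sets_into_space[OF null_setsD2[OF that(1)]] that(2) by simp
  ultimately have "sets G \<union> {N. \<exists>N'\<in>null_sets \<eta>. N \<subseteq> N'} \<subseteq> Pow (space \<eta>)"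
    by auto
  then show ?thesis by (simp add: negl_completion_def)
qed

text \<open>The sets that agree almost everywhere with a member of \<open>G\<close> form a
  sigma-field containing \<open>G\<close> and all negligible sets. \<open>A\<close> itself may fail
  to be \<eta>-measurable, which the formulation with \<open>AE\<close> tolerates.\<close>

lemma sets_negl_completion_ae:
  assumes G: "subalgebra \<eta> G" and A: "A \<in> sets (negl_completion \<eta> G)"
  shows "\<exists>B\<in>sets G. AE x in \<eta>. x \<in> A \<longleftrightarrow> x \<in> B"
  using A unfolding negl_completion_sets[OF G]
proof (induction rule: sigma_sets.induct)
  case (Basic a)
  then show ?case
  proof
    assume "a \<in> {N. \<exists>N'\<in>null_sets \<eta>. N \<subseteq> N'}"
    then obtain N where N: "N \<in> null_sets \<eta>" "a \<subseteq> N" by blast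
    then have "AE x in \<eta>. x \<in> a \<longleftrightarrow> x \<in> {}" using AE_not_in[OF N(1)] by auto
    then show ?thesis by blast
  qed auto
next
  case Empty
  then show ?case by (intro bexI[of _ "{}"]) auto
next
  case (Compl a)
  then obtain B where B: "B \<in> sets G" "AE x in \<eta>. x \<in> a \<longleftrightarrow> x \<in> B" by blast
  have "AE x in \<eta>. x \<in> space \<eta> - a \<longleftrightarrow> x \<in> space \<eta> - B"
    using B(2) by eventually_elim auto
  moreover have "space \<eta> - B \<in> sets G"
    using B(1) G sets.compl_sets[of B G] by (simp add: subalgebra_def)
  ultimately show ?case by blast
next
  case (Union a)
  then have "\<exists>B. \<forall>i. B i \<in> sets G \<and> (AE x in \<eta>. x \<in> a i \<longleftrightarrow> x \<in> B i)"
    by (intro choice) blast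
  then obtain B where B: "\<forall>i. B i \<in> sets G \<and> (AE x in \<eta>. x \<in> a i \<longleftrightarrow> x \<in> B i)" ..
  have "AE x in \<eta>. \<forall>i. x \<in> a i \<longleftrightarrow> x \<in> B i" using B by (simp add: AE_all_countable)
  then have "AE x in \<eta>. x \<in> (\<Union>i. a i) \<longleftrightarrow> x \<in> (\<Union>i. B i)"
    by eventually_elim auto
  moreover have "(\<Union>i. B i) \<in> sets G" using B by auto
  ultimately show ?case by blast
qed

text \<open>Induction from indicators through sums and increasing limits lifts the statement on sets
  to functions. It runs in \<open>ennreal\<close>, where suprema always exist; non-negativity allows
  the return to real values.\<close>

lemma borel_measurable_negl_completion_ae:
  fixes f :: "'a \<Rightarrow> real"
  assumes G: "subalgebra \<eta> G" and f: "f \<in> borel_measurable (negl_completion \<eta> G)"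
    and nonneg: "\<And>x. 0 \<le> f x"
  shows "\<exists>g\<in>borel_measurable G. AE x in \<eta>. f x = g x"
proof -
  have "\<exists>g\<in>borel_measurable G. AE x in \<eta>. u x = g x"
    if "u \<in> borel_measurable (negl_completion \<eta> G)" for u :: "'a \<Rightarrow> ennreal"
    using that
  proof (induction rule: borel_measurable_induct)
    case (cong f g)
    then obtain h where h: "h \<in> borel_measurable G" "AE x in \<eta>. g x = h x" by blast
    have "AE x in \<eta>. f x = h x" using h(2) AE_space by eventually_elim (use cong(3) in auto)
    then show ?case using h(1) by blast
  next
    case (set A)
    then obtain B where B: "B \<in> sets G" "AE x in \<eta>. x \<in> A \<longleftrightarrow> x \<in> B"
      using sets_negl_completion_ae[OF G] by blast
    have "AE x in \<eta>. indicator A x = (indicator B x :: ennreal)"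
      using B(2) by eventually_elim (auto simp: indicator_def)
    then show ?case using B(1) by (intro bexI[of _ "indicator B"]) auto
  next
    case (mult u c)
    then obtain h where [measurable]: "h \<in> borel_measurable G" and h: "AE x in \<eta>. u x = h x" by blast
    have "AE x in \<eta>. c * u x = c * h x" using h by eventually_elim auto
    then show ?case by (intro bexI[of _ "\<lambda>x. c * h x"]) auto
  next
    case (add u v)
    then obtain h k where [measurable]: "h \<in> borel_measurable G" "k \<in> borel_measurable G"
      and h: "AE x in \<eta>. u x = h x" "AE x in \<eta>. v x = k x" by blast
    have "AE x in \<eta>. v x + u x = k x + h x" using h by eventually_elim auto
    then show ?case by (intro bexI[of _ "\<lambda>x. k x + h x"]) auto
  next
    case (seq U)
    then have "\<exists>h. \<forall>i. h i \<in> borel_measurable G \<and> (AE x in \<eta>. U i x = h i x)"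
      by (intro choice) blast
    then obtain h where h: "\<forall>i. h i \<in> borel_measurable G \<and> (AE x in \<eta>. U i x = h i x)" ..
    have [measurable]: "h i \<in> borel_measurable G" for i using h by blast
    have "AE x in \<eta>. \<forall>i. U i x = h i x" using h by (simp add: AE_all_countable)
    then have "AE x in \<eta>. (SUP i. U i) x = (SUP i. h i x)"
      by eventually_elim (simp add: SUP_apply image_comp)
    then show ?case by (intro bexI[of _ "\<lambda>x. SUP i. h i x"]) auto
  qed
  from this[of "\<lambda>x. ennreal (f x)"] f obtain g where [measurable]: "g \<in> borel_measurable G"
    and g: "AE x in \<eta>. ennreal (f x) = g x" by auto
  have "AE x in \<eta>. f x = enn2real (g x)"
    using g by eventually_elim (drule sym, simp add: nonneg)
  then show ?thesis by (intro bexI[of _ "\<lambda>x. enn2real (g x)"]) auto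
qed

text \<open>Preimages under \<open>f\<close> and \<open>g\<close> differ only inside a null set, and
  the completion contains each of its subsets, however irregular \<open>f\<close> is there.\<close>

lemma borel_measurable_negl_completionI:
  assumes G: "subalgebra \<eta> G" and g: "g \<in> borel_measurable G" and ae: "AE x in \<eta>. f x = g x"
  shows "f \<in> borel_measurable (negl_completion \<eta> G)"
proof (rule measurableI)
  fix U :: "'b set" assume U: "U \<in> sets borel"
  obtain N where N: "\<And>x. x \<in> space \<eta> - N \<Longrightarrow> f x = g x" "N \<in> null_sets \<eta>"
    using ae by (rule AE_E3) (rule that)
  have sp: "space G = space \<eta>" using G by (simp add: subalgebra_def)
  have "N \<in> sets (negl_completion \<eta> G)" "f -` U \<inter> space \<eta> \<inter> N \<in> sets (negl_completion \<eta> G)"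
    "g -` U \<inter> space \<eta> \<in> sets (negl_completion \<eta> G)"
    using N(2) measurable_sets[OF g U] sp unfolding negl_completion_sets[OF G]
    by (auto intro!: sigma_sets.Basic)
  then have "((g -` U \<inter> space \<eta>) - N) \<union> (f -` U \<inter> space \<eta> \<inter> N) \<in> sets (negl_completion \<eta> G)"
    by auto
  moreover have "((g -` U \<inter> space \<eta>) - N) \<union> (f -` U \<inter> space \<eta> \<inter> N) = f -` U \<inter> space \<eta>"
    using N(1) by auto
  ultimately show "f -` U \<inter> space (negl_completion \<eta> G) \<in> sets (negl_completion \<eta> G)" by simp
qed simp

text \<open>Both sides of the inclusion are sigma-fields that contain the negligible sets, so it can
  be tested on the generating preimages. Causality thereby splits into conditions on one function at
  a time, the form in which it can pass to a limit.\<close>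

lemma sets_kernel_field_subset_iff:
  assumes sp: "space \<eta> = UNIV" and G: "subalgebra \<eta> G"
  shows "sets (kernel_field \<eta> \<nu> \<Theta> H) \<subseteq> sets (negl_completion \<eta> G) \<longleftrightarrow>
    (\<forall>C\<in>sets H. measure \<nu> (frontier C) = 0 \<longrightarrow>
      (\<lambda>x. measure (\<Theta> x) C) \<in> borel_measurable (negl_completion \<eta> G))"
    (is "_ \<longleftrightarrow> ?R")
proof -
  define gens where "gens = {(\<lambda>x. measure (\<Theta> x) C) -` U | C U.
    C \<in> sets H \<and> measure \<nu> (frontier C) = 0 \<and> U \<in> sets (borel :: real measure)}"
  define \<N> where "\<N> = {N. \<exists>N'\<in>null_sets \<eta>. N \<subseteq> N'}"
  have K: "sets (kernel_field \<eta> \<nu> \<Theta> H) = sigma_sets UNIV (sigma_sets UNIV gens \<union> \<N>)"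
    by (simp add: kernel_field_def negl_completion_def gens_def \<N>_def sp)
  have spF: "space (negl_completion \<eta> G) = UNIV" by (simp add: sp)
  have "\<N> \<subseteq> sets (negl_completion \<eta> G)"
    unfolding negl_completion_sets[OF G] \<N>_def by (auto intro!: sigma_sets.Basic)
  then have "sigma_sets UNIV (sigma_sets UNIV gens \<union> \<N>) \<subseteq> sets (negl_completion \<eta> G)"
    if "gens \<subseteq> sets (negl_completion \<eta> G)"
    using that sets.sigma_sets_subset[of _ "negl_completion \<eta> G"] unfolding spF by simp
  moreover have "gens \<subseteq> sigma_sets UNIV (sigma_sets UNIV gens \<union> \<N>)"
    by (auto intro: sigma_sets.Basic)
  ultimately have "sets (kernel_field \<eta> \<nu> \<Theta> H) \<subseteq> sets (negl_completion \<eta> G) \<longleftrightarrow>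
      gens \<subseteq> sets (negl_completion \<eta> G)"
    unfolding K by (intro iffI) (erule order_trans)
  also have "\<dots> \<longleftrightarrow> ?R"
  proof (intro iffI ballI impI)
    fix C assume "gens \<subseteq> sets (negl_completion \<eta> G)" "C \<in> sets H" "measure \<nu> (frontier C) = 0"
    then show "(\<lambda>x. measure (\<Theta> x) C) \<in> borel_measurable (negl_completion \<eta> G)"
      unfolding gens_def by (intro measurableI) (auto simp: sp)
  next
    assume *: ?R
    show "gens \<subseteq> sets (negl_completion \<eta> G)"
    proof
      fix A assume "A \<in> gens"
      then obtain C U where "A = (\<lambda>x. measure (\<Theta> x) C) -` U" "C \<in> sets H"
        "measure \<nu> (frontier C) = 0" "U \<in> sets (borel :: real measure)"
        unfolding gens_def by blast
      with * show "A \<in> sets (negl_completion \<eta> G)"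
        using measurable_sets[of "\<lambda>x. measure (\<Theta> x) C" "negl_completion \<eta> G" borel U]
        by (simp add: sp)
    qed
  qed
  finally show ?thesis .
qed

text \<open>Simple functions are dense in L1, and the uniform bound on \<open>f n\<close> makes the
  approximation error uniform in \<open>n\<close>. The extension beyond indicators is required
  because the conditional expectation of an indicator is a general integrable function.\<close>

lemma tendsto_integral_mult_of_sets:
  fixes f :: "nat \<Rightarrow> 'a \<Rightarrow> real"
  assumes \<eta>: "finite_measure \<eta>"
    and f[measurable]: "\<And>n. f n \<in> borel_measurable \<eta>" "\<And>n x. \<bar>f n x\<bar> \<le> 1"
    and h[measurable]: "h \<in> borel_measurable \<eta>" "\<And>x. \<bar>h x\<bar> \<le> 1"
    and conv: "\<And>A. A \<in> sets \<eta> \<Longrightarrow>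
      ((\<lambda>n. \<integral>x. indicator A x * f n x \<partial>\<eta>) \<longlongrightarrow> (\<integral>x. indicator A x * h x \<partial>\<eta>)) G"
    and g: "integrable \<eta> g"
  shows "((\<lambda>n. \<integral>x. g x * f n x \<partial>\<eta>) \<longlongrightarrow> (\<integral>x. g x * h x \<partial>\<eta>)) G"
proof -
  interpret finite_measure \<eta> by fact
  have int: "integrable \<eta> (\<lambda>x. u x * k x)"
    if "integrable \<eta> u" "k \<in> borel_measurable \<eta>" "\<And>x. \<bar>k x\<bar> \<le> 1" for u k :: "'a \<Rightarrow> real"
    by (rule Bochner_Integration.integrable_bound[OF that(1)])
      (use that in \<open>auto simp: abs_mult intro!: mult_left_le\<close>)
  have bd: "\<bar>(\<integral>x. u x * k x \<partial>\<eta>) - (\<integral>x. v x * k x \<partial>\<eta>)\<bar> \<le> (\<integral>x. \<bar>u x - v x\<bar> \<partial>\<eta>)"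
    if "integrable \<eta> u" "integrable \<eta> v" "k \<in> borel_measurable \<eta>" "\<And>x. \<bar>k x\<bar> \<le> 1"
    for u v k :: "'a \<Rightarrow> real"
  proof -
    have "(\<integral>x. u x * k x \<partial>\<eta>) - (\<integral>x. v x * k x \<partial>\<eta>) = (\<integral>x. (u x - v x) * k x \<partial>\<eta>)"
      using int that by (simp add: left_diff_distrib)
    also have "\<bar>\<dots>\<bar> \<le> (\<integral>x. \<bar>(u x - v x) * k x\<bar> \<partial>\<eta>)" by (rule integral_abs_bound)
    also have "\<dots> \<le> (\<integral>x. \<bar>u x - v x\<bar> \<partial>\<eta>)"
      using that by (intro integral_mono integrable_abs int)
        (auto simp: abs_mult intro!: mult_left_le)
    finally show ?thesis .
  qed
  show ?thesis
    using g
  proof (induct rule: integrable_induct)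
    case (base A c)
    then show ?case
      using tendsto_mult_left[OF conv[OF base(1)], of c] by (simp add: ac_simps)
  next
    case (add u v)
    then show ?case
      using tendsto_add[OF add(2,4)] int[OF _ f] int[OF _ h] by (simp add: distrib_right)
  next
    case (lim u s)
    note [measurable] = lim(1,5)[THEN borel_measurable_integrable]
    have "(\<lambda>i. \<integral>x. \<bar>s i x - u x\<bar> \<partial>\<eta>) \<longlonglongrightarrow> (\<integral>x. 0 \<partial>\<eta>)"
    proof (rule integral_dominated_convergence)
      \<comment> \<open>The approximants supplied by the induction satisfy |s i x| \<le> 2 |u x|,
        whence the factor 3.\<close>
      show "integrable \<eta> (\<lambda>x. 3 * \<bar>u x\<bar>)" using lim(5) by auto
      show "AE x in \<eta>. (\<lambda>i. \<bar>s i x - u x\<bar>) \<longlonglongrightarrow> 0"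
        using lim(3) by (intro AE_I2 tendsto_rabs_zero LIM_zero) auto
      show "AE x in \<eta>. norm \<bar>s i x - u x\<bar> \<le> 3 * \<bar>u x\<bar>" for i
        using lim(4)[of _ i] by (intro AE_I2) fastforce
    qed auto
    then have s0: "(\<lambda>i. \<integral>x. \<bar>s i x - u x\<bar> \<partial>\<eta>) \<longlonglongrightarrow> 0" by simp
    show ?case
    proof (rule tendstoI)
      fix e :: real assume e: "0 < e"
      from order_tendstoD(2)[OF s0, of "e / 3"] e obtain i where i: "(\<integral>x. \<bar>s i x - u x\<bar> \<partial>\<eta>) < e / 3"
        by (auto simp: eventually_sequentially)
      have "eventually (\<lambda>n. dist (\<integral>x. s i x * f n x \<partial>\<eta>) (\<integral>x. s i x * h x \<partial>\<eta>) < e / 3) G"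
        by (rule tendstoD[OF lim(2)]) (use e in simp)
      then show "eventually (\<lambda>n. dist (\<integral>x. u x * f n x \<partial>\<eta>) (\<integral>x. u x * h x \<partial>\<eta>) < e) G"
      proof eventually_elim
        case (elim n)
        have "\<bar>(\<integral>x. s i x * f n x \<partial>\<eta>) - (\<integral>x. u x * f n x \<partial>\<eta>)\<bar> < e / 3"
          using bd[OF lim(1)[of i] lim(5) f(1)[of n] f(2)[of n]] i by simp
        moreover have "\<bar>(\<integral>x. s i x * h x \<partial>\<eta>) - (\<integral>x. u x * h x \<partial>\<eta>)\<bar> < e / 3"
          using bd[OF lim(1)[of i] lim(5) h(1,2)] i by simp
        ultimately show ?case using elim unfolding dist_real_def by linarith
      qed
    qed
  qed
qed

text \<open>A bounded \<open>h\<close> agrees with its conditional expectation as soon as it is orthogonal to all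
  \<open>1\<^sub>A - E[1\<^sub>A | F]\<close>, and these relations pass to weak limits.\<close>

lemma weak_limit_subalgebra_measurable:
  fixes f :: "nat \<Rightarrow> 'a \<Rightarrow> real"
  assumes \<eta>: "finite_measure \<eta>" and F: "subalgebra \<eta> F" and G: "G \<noteq> bot"
    and f[measurable]: "\<And>n. f n \<in> borel_measurable \<eta>" "\<And>n x. \<bar>f n x\<bar> \<le> 1"
    and h[measurable]: "h \<in> borel_measurable \<eta>" "\<And>x. \<bar>h x\<bar> \<le> 1"
    and conv: "\<And>A. A \<in> sets \<eta> \<Longrightarrow>
      ((\<lambda>n. \<integral>x. indicator A x * f n x \<partial>\<eta>) \<longlongrightarrow> (\<integral>x. indicator A x * h x \<partial>\<eta>)) G"
    and fF: "\<And>n. \<exists>k\<in>borel_measurable F. AE x in \<eta>. f n x = k x"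
  shows "\<exists>k\<in>borel_measurable F. AE x in \<eta>. h x = k x"
proof -
  interpret finite_measure_subalgebra \<eta> F
    using \<eta> F by (simp add: finite_measure_subalgebra_def finite_measure_subalgebra_axioms_def)
  have int: "integrable \<eta> (\<lambda>x. u x * k x)"
    if "integrable \<eta> u" "k \<in> borel_measurable \<eta>" "\<And>x. \<bar>k x\<bar> \<le> 1" for u k :: "'a \<Rightarrow> real"
    by (rule Bochner_Integration.integrable_bound[OF that(1)])
      (use that in \<open>auto simp: abs_mult intro!: mult_left_le\<close>)
  have bint: "integrable \<eta> k" if "k \<in> borel_measurable \<eta>" "\<And>x. \<bar>k x\<bar> \<le> 1" for k :: "'a \<Rightarrow> real"
    using int[of "\<lambda>_. 1" k] that by simp
  let ?E = "real_cond_exp \<eta> F"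
  have "AE x in \<eta>. h x = ?E h x"
  proof (rule density_unique_real)
    show "integrable \<eta> h" "integrable \<eta> (?E h)" using bint[OF h] real_cond_exp_int(1)[OF bint[OF h]] by auto
    fix A assume A[measurable]: "A \<in> sets \<eta>"
    let ?I = "indicator A :: 'a \<Rightarrow> real"
    have iI: "integrable \<eta> ?I" by (rule bint) (auto simp: indicator_def)
    then have iE: "integrable \<eta> (?E ?I)" by (rule real_cond_exp_int(1))
    \<comment> \<open>\<open>f n\<close> is almost everywhere an F-measurable \<open>k\<close>,
      which can be pulled out of the conditional expectation of the indicator.\<close>
    have eq: "(\<integral>x. ?E ?I x * f n x \<partial>\<eta>) = (\<integral>x. ?I x * f n x \<partial>\<eta>)" for n
    proof -
      obtain k where k[measurable]: "k \<in> borel_measurable F" and ae: "AE x in \<eta>. f n x = k x"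
        using fF[of n] by blast
      have [measurable]: "k \<in> borel_measurable \<eta>" by (rule measurable_from_subalg[OF F k])
      have "integrable \<eta> (\<lambda>x. f n x * ?I x)"
        using int[OF iI f] by (simp add: mult.commute)
      then have "integrable \<eta> (\<lambda>x. k x * ?I x)"
        by (rule integrable_cong_AE_imp) (use ae in auto)
      from real_cond_exp_intg(2)[OF this k]
      have "(\<integral>x. k x * ?E ?I x \<partial>\<eta>) = (\<integral>x. k x * ?I x \<partial>\<eta>)" by simp
      moreover have "(\<integral>x. ?E ?I x * f n x \<partial>\<eta>) = (\<integral>x. k x * ?E ?I x \<partial>\<eta>)"
        by (rule integral_cong_AE) (use ae in auto)
      moreover have "(\<integral>x. ?I x * f n x \<partial>\<eta>) = (\<integral>x. k x * ?I x \<partial>\<eta>)"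
        by (rule integral_cong_AE) (use ae in auto)
      ultimately show ?thesis by simp
    qed
    have "((\<lambda>n. \<integral>x. ?E ?I x * f n x \<partial>\<eta>) \<longlongrightarrow> (\<integral>x. ?E ?I x * h x \<partial>\<eta>)) G"
      by (rule tendsto_integral_mult_of_sets[OF \<eta> f h conv iE])
    then have "(\<integral>x. ?I x * h x \<partial>\<eta>) = (\<integral>x. ?E ?I x * h x \<partial>\<eta>)"
      using tendsto_unique[OF G conv[OF A]] by (simp add: eq)
    \<comment> \<open>The conditional expectation is self-adjoint: it is moved from the indicator
      onto \<open>h\<close> through the symmetric product of the two conditional
      expectations.\<close>
    also have "\<dots> = (\<integral>x. ?E ?I x * ?E h x \<partial>\<eta>)"
      using real_cond_exp_intg(2)[OF int[OF iE h]] by simp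
    also have "\<dots> = (\<integral>x. ?E h x * ?E ?I x \<partial>\<eta>)" by (simp add: mult.commute)
    also have "\<dots> = (\<integral>x. ?E h x * ?I x \<partial>\<eta>)"
    proof (rule real_cond_exp_intg(2))
      show "integrable \<eta> (\<lambda>x. ?E h x * ?I x)"
        by (rule int) (use real_cond_exp_int(1)[OF bint[OF h]] in \<open>auto simp: indicator_def\<close>)
    qed auto
    finally show "(\<integral>x\<in>A. h x \<partial>\<eta>) = (\<integral>x\<in>A. ?E h x \<partial>\<eta>)"
      by (simp add: set_lebesgue_integral_def mult.commute)
  qed
  then show ?thesis by (intro bexI[of _ "?E h"]) auto
qed

section \<open>Causal plans\<close>

lemma prob_algebra_borelD:
  assumes "\<eta> \<in> space (prob_algebra (borel :: 'a::topological_space measure))"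
  shows "prob_space \<eta>" "sets \<eta> = sets borel" "space \<eta> = UNIV"
proof -
  show "prob_space \<eta>" and *: "sets \<eta> = sets borel"
    using assms by (auto simp: space_prob_algebra)
  from sets_eq_imp_space_eq[OF *] show "space \<eta> = UNIV" by simp
qed

lemma associated_kernelD:
  assumes K: "associated_kernel \<eta> \<gamma> \<Theta>" and \<eta>: "sets \<eta> = sets borel" and B: "B \<in> sets borel"
  shows "prob_space (\<Theta> x)" "sets (\<Theta> x) = sets borel"
    "(\<lambda>x. emeasure (\<Theta> x) B) \<in> borel_measurable \<eta>" "(\<lambda>x. measure (\<Theta> x) B) \<in> borel_measurable \<eta>"
    "\<bar>measure (\<Theta> x) B\<bar> \<le> 1"
proof -
  have \<Theta>: "\<Theta> \<in> borel \<rightarrow>\<^sub>M prob_algebra borel"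
    using K by (simp add: associated_kernel_def)
  then show p: "prob_space (\<Theta> x)" "sets (\<Theta> x) = sets borel"
    using measurable_space[OF \<Theta>, of x] by (auto simp: space_prob_algebra)
  have "\<Theta> \<in> \<eta> \<rightarrow>\<^sub>M subprob_algebra borel"
    using measurable_prob_algebraD[OF \<Theta>] measurable_cong_sets[OF \<eta> refl] by blast
  then show em: "(\<lambda>x. emeasure (\<Theta> x) B) \<in> borel_measurable \<eta>"
    using B by (rule measurable_emeasure_kernel)
  show "(\<lambda>x. measure (\<Theta> x) B) \<in> borel_measurable \<eta>"
    unfolding measure_def using em by measurable
  show "\<bar>measure (\<Theta> x) B\<bar> \<le> 1" using prob_space.prob_le_1[OF p(1)] by simp
qed

text \<open>Integrals of the kernel against indicators are masses of rectangles, so convergence on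
  rectangles becomes weak convergence of the kernels at a fixed set.\<close>

lemma integral_associated_kernel:
  assumes K: "associated_kernel \<eta> \<gamma> \<Theta>" and \<eta>: "sets \<eta> = sets borel"
    and A: "A \<in> sets borel" and B: "B \<in> sets borel"
  shows "(\<integral>x. indicator A x * measure (\<Theta> x) B \<partial>\<eta>) = measure \<gamma> (A \<times> B)"
proof -
  have [measurable]: "A \<in> sets \<eta>" using A \<eta> by simp
  note [measurable] = associated_kernelD(4)[OF K \<eta> B]
  have "(\<integral>x. indicator A x * measure (\<Theta> x) B \<partial>\<eta>) =
      enn2real (\<integral>\<^sup>+x. ennreal (indicator A x * measure (\<Theta> x) B) \<partial>\<eta>)"
    by (rule integral_eq_nn_integral) auto
  also have "(\<integral>\<^sup>+x. ennreal (indicator A x * measure (\<Theta> x) B) \<partial>\<eta>) = (\<integral>\<^sup>+x\<in>A. emeasure (\<Theta> x) B \<partial>\<eta>)"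
    using associated_kernelD(1)[OF K \<eta> B]
    by (intro nn_integral_cong)
      (auto simp: finite_measure.emeasure_eq_measure prob_space_def split: split_indicator)
  also have "\<dots> = emeasure \<gamma> (A \<times> B)"
    using K A B by (simp add: associated_kernel_def)
  finally show ?thesis by (simp add: measure_def)
qed

lemma exists_plan_of_kernel:
  fixes \<eta> :: "'a::second_countable_topology measure"
    and \<Theta> :: "'a \<Rightarrow> 'b::second_countable_topology measure"
  assumes \<eta>: "\<eta> \<in> space (prob_algebra borel)" and \<Theta>: "\<Theta> \<in> borel \<rightarrow>\<^sub>M prob_algebra borel"
  obtains \<gamma> where "\<gamma> \<in> space (prob_algebra borel)" "associated_kernel \<eta> \<gamma> \<Theta>"
proof -
  \<comment> \<open>\<open>D x\<close> is the product of the Dirac mass at \<open>x\<close> with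
    \<open>\<Theta> x\<close>; averaging it over \<open>\<eta>\<close> gives the plan.\<close>
  define D where "D x = distr (\<Theta> x) borel (Pair x)" for x
  have P: "Pair x \<in> \<Theta> x \<rightarrow>\<^sub>M borel" and pr: "prob_space (\<Theta> x)" and se: "sets (\<Theta> x) = sets borel" for x
  proof -
    show "prob_space (\<Theta> x)" and s: "sets (\<Theta> x) = sets borel"
      using measurable_space[OF \<Theta>, of x] by (auto simp: space_prob_algebra)
    have "Pair x \<in> borel \<rightarrow>\<^sub>M (borel :: ('a \<times> 'b) measure)"
      unfolding borel_prod[symmetric] by simp
    then show "Pair x \<in> \<Theta> x \<rightarrow>\<^sub>M borel" using measurable_cong_sets[OF s refl] by blast
  qed
  have eD: "emeasure (D x) (A \<times> B) = emeasure (\<Theta> x) B * indicator A x"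
    if "A \<in> sets borel" "B \<in> sets borel" for A B x
  proof -
    have "A \<times> B \<in> sets (borel :: ('a \<times> 'b) measure)"
      unfolding borel_prod[symmetric] using that by simp
    then have "emeasure (D x) (A \<times> B) = emeasure (\<Theta> x) (Pair x -` (A \<times> B) \<inter> space (\<Theta> x))"
      unfolding D_def by (rule emeasure_distr[OF P])
    moreover have "space (\<Theta> x) = UNIV" using sets_eq_imp_space_eq[OF se] by simp
    ultimately show ?thesis by (auto simp: indicator_def)
  qed
  have Dm: "D \<in> borel \<rightarrow>\<^sub>M prob_algebra borel"
  proof (rule measurable_prob_algebra_generated)
    show "sets (borel :: ('a \<times> 'b) measure) =
        sigma_sets UNIV {A \<times> B |A B. A \<in> sets (borel :: 'a measure) \<and> B \<in> sets (borel :: 'b measure)}"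
      unfolding borel_prod[symmetric] by (simp add: sets_pair_measure)
    show "Int_stable {A \<times> B |A B. A \<in> sets (borel :: 'a measure) \<and> B \<in> sets (borel :: 'b measure)}"
      by (rule Int_stable_pair_measure_generator)
    show "prob_space (D x)" for x
      unfolding D_def by (rule prob_space.prob_space_distr[OF pr P])
    show "sets (D x) = sets borel" for x by (simp add: D_def)
    fix X assume "X \<in> {A \<times> B |A B. A \<in> sets (borel :: 'a measure) \<and> B \<in> sets (borel :: 'b measure)}"
    then obtain A B where X: "X = A \<times> B" and AB: "A \<in> sets borel" "B \<in> sets borel" by auto
    have [measurable]: "(\<lambda>x. emeasure (\<Theta> x) B) \<in> borel_measurable borel"
      using measurable_prob_algebraD[OF \<Theta>] AB(2) by (rule measurable_emeasure_kernel)
    show "(\<lambda>x. emeasure (D x) X) \<in> borel_measurable borel"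
      unfolding X eD[OF AB] using AB(1) by measurable
  qed simp
  show thesis
  proof
    show "\<eta> \<bind> D \<in> space (prob_algebra borel)"
      using prob_space_bind'[OF \<eta> Dm] sets_bind'[OF \<eta> Dm] by (simp add: space_prob_algebra)
    have "emeasure (\<eta> \<bind> D) (A \<times> B) = (\<integral>\<^sup>+x\<in>A. emeasure (\<Theta> x) B \<partial>\<eta>)"
      if "A \<in> sets borel" "B \<in> sets borel" for A B
    proof -
      have "A \<times> B \<in> sets (borel :: ('a \<times> 'b) measure)"
        unfolding borel_prod[symmetric] using that by simp
      then show ?thesis by (subst emeasure_bind_prob_algebra[OF \<eta> Dm]) (simp_all add: eD that)
    qed
    then show "associated_kernel \<eta> (\<eta> \<bind> D) \<Theta>"
      using \<Theta> by (simp add: associated_kernel_def)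
  qed
qed

text \<open>Expresses the marginals by masses of rectangles, the only quantities whose limits are
  controlled.\<close>

lemma transport_plans_iff:
  fixes \<eta> :: "'a::second_countable_topology measure"
    and \<nu> :: "'b::second_countable_topology measure"
  assumes \<eta>: "\<eta> \<in> space (prob_algebra borel)" and \<nu>: "\<nu> \<in> space (prob_algebra borel)"
  shows "\<gamma> \<in> transport_plans \<eta> \<nu> \<longleftrightarrow> \<gamma> \<in> space (prob_algebra borel) \<and>
    (\<forall>A\<in>sets borel. measure \<gamma> (A \<times> UNIV) = measure \<eta> A) \<and>
    (\<forall>B\<in>sets borel. measure \<gamma> (UNIV \<times> B) = measure \<nu> B)"
proof -
  have "(distr \<gamma> borel fst = \<eta> \<longleftrightarrow> (\<forall>A\<in>sets borel. measure \<gamma> (A \<times> UNIV) = measure \<eta> A)) \<and>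
    (distr \<gamma> borel snd = \<nu> \<longleftrightarrow> (\<forall>B\<in>sets borel. measure \<gamma> (UNIV \<times> B) = measure \<nu> B))"
    if "\<gamma> \<in> space (prob_algebra borel)"
  proof -
    note \<gamma> = prob_algebra_borelD[OF that]
    interpret \<gamma>: prob_space \<gamma> by (rule \<gamma>(1))
    interpret \<eta>: prob_space \<eta> by (rule prob_algebra_borelD(1)[OF \<eta>])
    interpret \<nu>: prob_space \<nu> by (rule prob_algebra_borelD(1)[OF \<nu>])
    have m: "fst \<in> \<gamma> \<rightarrow>\<^sub>M borel" "snd \<in> \<gamma> \<rightarrow>\<^sub>M borel"
      unfolding measurable_cong_sets[OF \<gamma>(2)[folded borel_prod] refl] by measurable
    have e1: "measure (distr \<gamma> borel fst) A = measure \<gamma> (A \<times> UNIV)" if "A \<in> sets borel" for A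
      using that by (auto simp: measure_distr[OF m(1)] \<gamma>(3) intro!: arg_cong[where f = "measure \<gamma>"])
    have e2: "measure (distr \<gamma> borel snd) B = measure \<gamma> (UNIV \<times> B)" if "B \<in> sets borel" for B
      using that by (auto simp: measure_distr[OF m(2)] \<gamma>(3) intro!: arg_cong[where f = "measure \<gamma>"])
    have "distr \<gamma> borel fst = \<eta> \<longleftrightarrow> (\<forall>A\<in>sets borel. measure (distr \<gamma> borel fst) A = measure \<eta> A)"
    proof
      assume *: "\<forall>A\<in>sets borel. measure (distr \<gamma> borel fst) A = measure \<eta> A"
      interpret D: prob_space "distr \<gamma> borel fst" by (rule \<gamma>.prob_space_distr[OF m(1)])
      show "distr \<gamma> borel fst = \<eta>"
        by (rule measure_eqI) (use * prob_algebra_borelD(2)[OF \<eta>] in \<open>auto simp: D.emeasure_eq_measure \<eta>.emeasure_eq_measure\<close>)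
    qed simp
    moreover have "distr \<gamma> borel snd = \<nu> \<longleftrightarrow> (\<forall>B\<in>sets borel. measure (distr \<gamma> borel snd) B = measure \<nu> B)"
    proof
      assume *: "\<forall>B\<in>sets borel. measure (distr \<gamma> borel snd) B = measure \<nu> B"
      interpret D: prob_space "distr \<gamma> borel snd" by (rule \<gamma>.prob_space_distr[OF m(2)])
      show "distr \<gamma> borel snd = \<nu>"
        by (rule measure_eqI) (use * prob_algebra_borelD(2)[OF \<nu>] in \<open>auto simp: D.emeasure_eq_measure \<nu>.emeasure_eq_measure\<close>)
    qed simp
    ultimately show ?thesis using e1 e2 by simp
  qed
  then show ?thesis by (auto simp: transport_plans_def)
qed

lemma subalgebra_of_borel:
  assumes "\<eta> \<in> space (prob_algebra borel)" "subalgebra borel G"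
  shows "subalgebra \<eta> G"
  using assms prob_algebra_borelD[OF assms(1)] by (simp add: subalgebra_def)

text \<open>The product of \<open>\<eta>\<close> and \<open>\<nu>\<close> is causal: its kernel is
  constant, and constants are measurable for every sigma-field.\<close>

lemma causal_plans_nonempty:
  fixes \<eta> :: "'a::second_countable_topology measure"
    and \<nu> :: "'b::second_countable_topology measure"
  assumes F: "borel_filtration I F"
    and \<eta>: "\<eta> \<in> space (prob_algebra borel)" and \<nu>: "\<nu> \<in> space (prob_algebra borel)"
  shows "causal_plans I F H \<eta> \<nu> \<noteq> {}"
proof -
  note E = prob_algebra_borelD[OF \<eta>] and S = prob_algebra_borelD[OF \<nu>]
  have const: "(\<lambda>_. \<nu>) \<in> borel \<rightarrow>\<^sub>M prob_algebra borel" using \<nu> by simp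
  obtain \<gamma> where \<gamma>: "\<gamma> \<in> space (prob_algebra borel)" and K: "associated_kernel \<eta> \<gamma> (\<lambda>_. \<nu>)"
    by (rule exists_plan_of_kernel[OF \<eta> const])
  have rect: "measure \<gamma> (A \<times> B) = measure \<eta> A * measure \<nu> B" if "A \<in> sets borel" "B \<in> sets borel" for A B
    using integral_associated_kernel[OF K E(2) that] that E(2) by simp
  have "\<gamma> \<in> transport_plans \<eta> \<nu>"
    unfolding transport_plans_iff[OF \<eta> \<nu>]
    using \<gamma> rect prob_space.prob_space[OF E(1)] prob_space.prob_space[OF S(1)] E(3) S(3) by simp
  moreover have "sets (kernel_field \<eta> \<nu> (\<lambda>_. \<nu>) (H t)) \<subseteq> sets (negl_completion \<eta> (F t))" if "t \<in> I" for t
  proof -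
    have "subalgebra \<eta> (F t)"
      using F that subalgebra_of_borel[OF \<eta>] by (simp add: borel_filtration_def)
    then show ?thesis by (simp add: sets_kernel_field_subset_iff[OF E(3)])
  qed
  ultimately have "\<gamma> \<in> causal_plans I F H \<eta> \<nu>" using K by (auto simp: causal_plans_def)
  then show ?thesis by blast
qed

theorem causal_plans_compact:
  fixes \<eta> :: "'a::polish_space measure" and \<nu> :: "'b::polish_space measure"
  assumes F: "borel_filtration I F" and H: "borel_filtration I H"
    and \<eta>: "\<eta> \<in> space (prob_algebra borel)" and \<nu>: "\<nu> \<in> space (prob_algebra borel)"
    and \<gamma>: "\<And>n :: nat. \<gamma> n \<in> causal_plans I F H \<eta> \<nu>"
  obtains \<gamma>' G where "\<gamma>' \<in> causal_plans I F H \<eta> \<nu>" "G \<noteq> bot" "G \<le> sequentially"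
    "\<And>A B. A \<in> sets borel \<Longrightarrow> B \<in> sets borel \<Longrightarrow>
      ((\<lambda>n. measure (\<gamma> n) (A \<times> B)) \<longlongrightarrow> measure \<gamma>' (A \<times> B)) G"
proof -
  note E = prob_algebra_borelD[OF \<eta>] and S = prob_algebra_borelD[OF \<nu>]
  interpret \<eta>: prob_space \<eta> by (rule E(1))
  have tp: "\<gamma> n \<in> transport_plans \<eta> \<nu>" for n
    using \<gamma> by (simp add: causal_plans_def)
  note tp' = tp[unfolded transport_plans_iff[OF \<eta> \<nu>]]
  have pr: "\<gamma> n \<in> space (prob_algebra borel)" for n using tp' by simp
  note C = prob_algebra_borelD[OF pr]
  have "\<exists>\<Theta>. \<forall>n. associated_kernel \<eta> (\<gamma> n) (\<Theta> n) \<and>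
      (\<forall>t\<in>I. sets (kernel_field \<eta> \<nu> (\<Theta> n) (H t)) \<subseteq> sets (negl_completion \<eta> (F t)))"
    using \<gamma> by (intro choice) (simp add: causal_plans_def)
  then obtain \<Theta> where K: "\<And>n. associated_kernel \<eta> (\<gamma> n) (\<Theta> n)"
    and causal: "\<And>n t. t \<in> I \<Longrightarrow> sets (kernel_field \<eta> \<nu> (\<Theta> n) (H t)) \<subseteq> sets (negl_completion \<eta> (F t))"
    by auto
  \<comment> \<open>The cube is indexed by all pairs of sets. On non-measurable rectangles
    \<open>measure\<close> still takes values between 0 and 1, so no restriction of the index type
    is required.\<close>
  obtain G m' where G: "G \<noteq> bot" "G \<le> sequentially"
    and m': "\<And>i. ((\<lambda>n. case i of (A, B) \<Rightarrow> measure (\<gamma> n) (A \<times> B)) \<longlongrightarrow> m' i) G"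
    by (rule pointwise_cluster_filter[of "\<lambda>n i. case i of (A, B) \<Rightarrow> measure (\<gamma> n) (A \<times> B)"])
      (use prob_space.prob_le_1[OF C(1)] in \<open>auto split: prod.split\<close>)
  define m where "m A B = m' (A, B)" for A B
  have m: "((\<lambda>n. measure (\<gamma> n) (A \<times> B)) \<longlongrightarrow> m A B) G" for A B
    using m'[of "(A, B)"] by (simp add: m_def)
  have limI: "m A B = x" if "((\<lambda>n. measure (\<gamma> n) (A \<times> B)) \<longlongrightarrow> x) G" for A B x
    using tendsto_unique[OF G(1) m that] .
  have rect: "A \<times> B \<in> sets (\<gamma> n)" if "A \<in> sets borel" "B \<in> sets borel" for A B n
    unfolding C(2) borel_prod[symmetric] using that by simp
  have Un: "measure (\<gamma> n) (X \<union> Y) = measure (\<gamma> n) X + measure (\<gamma> n) Y"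
    if "X \<in> sets (\<gamma> n)" "Y \<in> sets (\<gamma> n)" "X \<inter> Y = {}" for X Y n
    using finite_measure.finite_measure_Union[OF prob_space.axioms(1)[OF C(1)] that] .
  have m_nonneg: "0 \<le> m A B" for A B
    by (rule tendsto_lowerbound[OF m]) (use G(1) in auto)
  obtain \<Phi> where \<Phi>: "\<Phi> \<in> \<eta> \<rightarrow>\<^sub>M prob_algebra borel"
    and \<Phi>m: "\<And>A B. A \<in> sets \<eta> \<Longrightarrow> B \<in> sets borel \<Longrightarrow>
      (\<integral>\<^sup>+x\<in>A. emeasure (\<Phi> x) B \<partial>\<eta>) = ennreal (m A B)"
  proof (rule bimeasure_disintegration[of \<eta> \<nu> m])
    show "prob_space \<eta>" "prob_space \<nu>" "sets \<nu> = sets borel" by fact+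
    show "0 \<le> m A B" for A B by (rule m_nonneg)
    show "m (A \<union> A') B = m A B + m A' B"
      if "A \<in> sets \<eta>" "A' \<in> sets \<eta>" "A \<inter> A' = {}" "B \<in> sets borel" for A A' B
    proof (rule limI)
      have "measure (\<gamma> n) ((A \<union> A') \<times> B) = measure (\<gamma> n) (A \<times> B) + measure (\<gamma> n) (A' \<times> B)" for n
        unfolding Sigma_Un_distrib1 using that E(2) by (intro Un rect) auto
      then show "((\<lambda>n. measure (\<gamma> n) ((A \<union> A') \<times> B)) \<longlongrightarrow> m A B + m A' B) G"
        by (simp add: tendsto_add[OF m m])
    qed
    show "m A (B \<union> B') = m A B + m A B'"
      if "A \<in> sets \<eta>" "B \<in> sets borel" "B' \<in> sets borel" "B \<inter> B' = {}" for A B B'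
    proof (rule limI)
      have "measure (\<gamma> n) (A \<times> (B \<union> B')) = measure (\<gamma> n) (A \<times> B) + measure (\<gamma> n) (A \<times> B')" for n
        unfolding Sigma_Un_distrib2 using that E(2) by (intro Un rect) auto
      then show "((\<lambda>n. measure (\<gamma> n) (A \<times> (B \<union> B'))) \<longlongrightarrow> m A B + m A B') G"
        by (simp add: tendsto_add[OF m m])
    qed
    show "m A UNIV = measure \<eta> A" if "A \<in> sets \<eta>" for A
      using tp' that E(2) by (intro limI) simp
    show "m (space \<eta>) B = measure \<nu> B" if "B \<in> sets borel" for B
      using tp' that E(3) by (intro limI) simp
  qed (rule that)
  have \<Phi>b: "\<Phi> \<in> borel \<rightarrow>\<^sub>M prob_algebra borel"
    using \<Phi> measurable_cong_sets[OF E(2) refl] by blast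
  obtain \<gamma>' where \<gamma>': "\<gamma>' \<in> space (prob_algebra borel)" and K': "associated_kernel \<eta> \<gamma>' \<Phi>"
    by (rule exists_plan_of_kernel[OF \<eta> \<Phi>b])
  have m\<gamma>': "measure \<gamma>' (A \<times> B) = m A B" if "A \<in> sets borel" "B \<in> sets borel" for A B
  proof -
    have "emeasure \<gamma>' (A \<times> B) = ennreal (m A B)"
      using K' \<Phi>m that E(2) by (simp add: associated_kernel_def)
    then show ?thesis using m_nonneg by (simp add: measure_def)
  qed
  have lim: "((\<lambda>n. measure (\<gamma> n) (A \<times> B)) \<longlongrightarrow> measure \<gamma>' (A \<times> B)) G"
    if "A \<in> sets borel" "B \<in> sets borel" for A B
    unfolding m\<gamma>'[OF that] by (rule m)
  have "\<gamma>' \<in> transport_plans \<eta> \<nu>"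
    unfolding transport_plans_iff[OF \<eta> \<nu>]
  proof (intro conjI ballI \<gamma>')
    show "measure \<gamma>' (A \<times> UNIV) = measure \<eta> A" if "A \<in> sets borel" for A
      using tp' that by (simp add: m\<gamma>' limI)
    show "measure \<gamma>' (UNIV \<times> B) = measure \<nu> B" if "B \<in> sets borel" for B
      using tp' that by (simp add: m\<gamma>' limI)
  qed
  moreover have "sets (kernel_field \<eta> \<nu> \<Phi> (H t)) \<subseteq> sets (negl_completion \<eta> (F t))" if t: "t \<in> I" for t
  proof -
    have sub: "subalgebra \<eta> (F t)"
      using F t subalgebra_of_borel[OF \<eta>] by (simp add: borel_filtration_def)
    show ?thesis
      unfolding sets_kernel_field_subset_iff[OF E(3) sub]
    proof (intro ballI impI)
      fix C assume C: "C \<in> sets (H t)" "measure \<nu> (frontier C) = 0"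
      have Cb: "C \<in> sets borel"
        using H t C(1) by (auto simp: borel_filtration_def subalgebra_def)
      \<comment> \<open>For this fixed \<open>C\<close> the functions \<open>\<Theta> n x C\<close>
        converge weakly to \<open>\<Phi> x C\<close>, because their integrals over \<open>A\<close>
        are the masses of the rectangle \<open>A \<times> C\<close>.\<close>
      have "\<exists>k\<in>borel_measurable (F t). AE x in \<eta>. measure (\<Phi> x) C = k x"
      proof (rule weak_limit_subalgebra_measurable[OF \<eta>.finite_measure_axioms sub G(1)])
        show "(\<lambda>x. measure (\<Theta> n x) C) \<in> borel_measurable \<eta>" "\<bar>measure (\<Theta> n x) C\<bar> \<le> 1" for n x
          using associated_kernelD(4,5)[OF K E(2) Cb] by auto
        show "(\<lambda>x. measure (\<Phi> x) C) \<in> borel_measurable \<eta>" "\<bar>measure (\<Phi> x) C\<bar> \<le> 1" for x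
          using associated_kernelD(4,5)[OF K' E(2) Cb] by auto
        show "((\<lambda>n. \<integral>x. indicator A x * measure (\<Theta> n x) C \<partial>\<eta>) \<longlongrightarrow>
            (\<integral>x. indicator A x * measure (\<Phi> x) C \<partial>\<eta>)) G" if "A \<in> sets \<eta>" for A
          using that E(2) lim[OF _ Cb]
          by (simp add: integral_associated_kernel[OF K E(2) _ Cb] integral_associated_kernel[OF K' E(2) _ Cb])
        show "\<exists>k\<in>borel_measurable (F t). AE x in \<eta>. measure (\<Theta> n x) C = k x" for n
          using causal[OF t, of n] C unfolding sets_kernel_field_subset_iff[OF E(3) sub]
          by (intro borel_measurable_negl_completion_ae[OF sub]) auto
      qed
      then obtain k where "k \<in> borel_measurable (F t)" "AE x in \<eta>. measure (\<Phi> x) C = k x" by blast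
      then show "(\<lambda>x. measure (\<Phi> x) C) \<in> borel_measurable (negl_completion \<eta> (F t))"
        by (rule borel_measurable_negl_completionI[OF sub])
    qed
  qed
  ultimately have "\<gamma>' \<in> causal_plans I F H \<eta> \<nu>" using K' by (auto simp: causal_plans_def)
  then show thesis by (rule that[OF _ G lim])
qed

theorem corollary1:
  fixes I :: "'i::linorder set"
    and F :: "'i \<Rightarrow> 'a::polish_space measure"
    and H :: "'i \<Rightarrow> 'b::polish_space measure"
    and c :: "'a \<times> 'b \<Rightarrow> ennreal"
    and \<eta> :: "'a measure" and \<nu> :: "'b measure"
  assumes "borel_filtration I F" and "borel_filtration I H"
    and "lower_semicontinuous c"
    and "\<eta> \<in> space (prob_algebra borel)" and "\<nu> \<in> space (prob_algebra borel)"
  shows "\<exists>\<gamma>\<in>causal_plans I F H \<eta> \<nu>.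
    (\<integral>\<^sup>+z. c z \<partial>\<gamma>) = (INF \<gamma>'\<in>causal_plans I F H \<eta> \<nu>. \<integral>\<^sup>+z. c z \<partial>\<gamma>')"
proof -
  let ?P = "causal_plans I F H \<eta> \<nu>" and ?J = "\<lambda>\<gamma>. \<integral>\<^sup>+z. c z \<partial>\<gamma>"
  define V where "V = (INF \<gamma>\<in>?P. ?J \<gamma>)"
  \<comment> \<open>A minimizing sequence exists only over a nonempty set of plans. An infinite
    infimum needs no separate treatment.\<close>
  have "?P \<noteq> {}" by (rule causal_plans_nonempty[OF assms(1,4,5)])
  then obtain v where v: "decseq v" "range v \<subseteq> ?J ` ?P" "V = (INF n. v n)"
    unfolding V_def using ennreal_Inf_countable_INF[of "?J ` ?P"] by auto
  have "\<exists>\<gamma>. \<gamma> \<in> ?P \<and> ?J \<gamma> = v n" for n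
  proof -
    have "v n \<in> ?J ` ?P" using v(2) by blast
    then show ?thesis by auto
  qed
  then have "\<exists>\<gamma>. \<forall>n. \<gamma> n \<in> ?P \<and> ?J (\<gamma> n) = v n" by (intro choice allI)
  then obtain \<gamma> where \<gamma>: "\<And>n. \<gamma> n \<in> ?P" "\<And>n. ?J (\<gamma> n) = v n" by auto
  obtain \<gamma>' G where \<gamma>': "\<gamma>' \<in> ?P" and G: "G \<noteq> bot" "G \<le> sequentially"
    and lim: "\<And>A B. A \<in> sets borel \<Longrightarrow> B \<in> sets borel \<Longrightarrow>
      ((\<lambda>n. measure (\<gamma> n) (A \<times> B)) \<longlongrightarrow> measure \<gamma>' (A \<times> B)) G"
    by (rule causal_plans_compact[where \<gamma> = \<gamma>, OF assms(1,2,4,5)]) (rule \<gamma>(1), rule that)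
  have pr: "\<rho> \<in> space (prob_algebra borel)" if "\<rho> \<in> ?P" for \<rho>
    using that by (simp add: causal_plans_def transport_plans_def)
  have "?J \<gamma>' \<le> V"
  proof (rule lsc_nn_integral_le_limit[OF G(1)])
    show "prob_space (\<gamma> n)" "sets (\<gamma> n) = sets borel" for n
      using prob_algebra_borelD[OF pr[OF \<gamma>(1)]] by auto
    show "prob_space \<gamma>'" "sets \<gamma>' = sets borel"
      using prob_algebra_borelD[OF pr[OF \<gamma>']] by auto
    \<comment> \<open>The costs converge along the whole sequence, hence along the finer filter
      \<open>G\<close>.\<close>
    have "v \<longlonglongrightarrow> V" using LIMSEQ_INF[OF v(1)] v(3) by simp
    then show "((\<lambda>n. ?J (\<gamma> n)) \<longlongrightarrow> V) G"
      unfolding \<gamma>(2) by (rule filterlim_mono[OF _ order_refl G(2)])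
  qed (use lim assms(3) in auto)
  moreover have "V \<le> ?J \<gamma>'" unfolding V_def using \<gamma>' by (rule INF_lower)
  ultimately show ?thesis using \<gamma>' unfolding V_def[symmetric] by (intro bexI[of _ \<gamma>']) auto
qed

end
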